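(* Suppose that $d\ge1$, $\omega:[0,+\infty)\to(0,+\infty)$ is a weight function, $\mu$ is a positive Borel measure on $\mathbb{C}^d$, and $0<q<\infty$. Then $\mu$ is a $q$-Carleson measure for $\mathcal{A}^\omega(\mathbb{C}^d)$ if and only if $$\int_{\mathbb{C}^d}\widetilde{\omega}^{\,q}(|z|)\,d\mu(z)<\infty,$$ where $\widetilde{\omega}$ denotes the associated weight function of $\omega$.
   Context: $\mathcal{H}ol(\mathbb{C}^d)$ is the space of entire functions on $\mathbb{C}^d$. A weight function is a non-decreasing, continuous, unbounded function $\omega:[0,+\infty)\to(0,+\infty)$; it is always assumed in addition that $\lim_{t\to+\infty}t^{-k}\omega(t)=\infty$ for all $k\in\mathbb{N}$. The growth space $\mathcal{A}^\omega(\mathbb{C}^d)$ consists of those $f\in\mathcal{H}ol(\mathbb{C}^d)$ with $\sup_{z\in\mathbb{C}^d}|f(z)|/\omega(|z|)<\infty$. The associated weight function $\widetilde{\omega}:[0,+\infty)\to(0,+\infty)$ is defined by $\widetilde{\omega}(|z|)=\sup\{|f(z)|: f\in\mathcal{H}ol(\mathbb{C}),\ |f(w)|\le\omega(|w|)\text{ for all }w\in\mathbb{C}\}$, $z\in\mathbb{C}$ (the supremum depends only on $|z|$; the analogous supremum over $\mathcal{H}ol(\mathbb{C}^d)$ yields the same function for every $d\ge1$). A positive Borel measure $\mu$ on $\mathbb{C}^d$ is called $q$-Carleson for a linear space $X\subset\mathcal{H}ol(\mathbb{C}^d)$ if $X\subset L^q(\mathbb{C}^d,\mu)$. *)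

theory Defs
  imports "HOL-Analysis.Analysis"
begin

definition weight_function :: "(real \<Rightarrow> real) \<Rightarrow> bool" where
  "weight_function \<omega> \<longleftrightarrow>
     (\<forall>t\<ge>0. \<omega> t > 0) \<and>
     mono_on {0..} \<omega> \<and>
     continuous_on {0..} \<omega> \<and>
     \<not> bdd_above (\<omega> ` {0..}) \<and>
     (\<forall>k::nat. filterlim (\<lambda>t. \<omega> t / t ^ k) at_top at_top)"

text \<open>Holomorphy in several variables: the (real) Frechet derivative exists at every point and is
  complex linear. The norm on \<open>complex ^ 'd\<close> is the Euclidean one.\<close>

definition entire :: "(complex ^ 'd \<Rightarrow> complex) \<Rightarrow> bool" where
  "entire f \<longleftrightarrow>
     (\<forall>z. \<exists>f'. (f has_derivative f') (at z) \<and> (\<forall>c v. f' (c *s v) = c * f' v))"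

definition growth_space :: "(real \<Rightarrow> real) \<Rightarrow> (complex ^ 'd \<Rightarrow> complex) set" where
  "growth_space \<omega> = {f. entire f \<and> bdd_above (range (\<lambda>z. norm (f z) / \<omega> (norm z)))}"

text \<open>The supremum below, taken at a point of \<open>\<complex>\<close>, depends only on the modulus of that point; it is
  evaluated here at the nonnegative real representative, see \<open>associated_weight_cmod\<close>.\<close>

definition associated_weight :: "(real \<Rightarrow> real) \<Rightarrow> real \<Rightarrow> real" where
  "associated_weight \<omega> t =
     (SUP f\<in>{f. f holomorphic_on UNIV \<and> (\<forall>w. cmod (f w) \<le> \<omega> (cmod w))}. cmod (f (of_real t)))"

lemma associated_weight_cmod:
  "associated_weight \<omega> (cmod z) =
     (SUP f\<in>{f. f holomorphic_on UNIV \<and> (\<forall>w. cmod (f w) \<le> \<omega> (cmod w))}. cmod (f z))"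
proof -
  define F where "F = {f. f holomorphic_on UNIV \<and> (\<forall>w. cmod (f w) \<le> \<omega> (cmod w))}"
  have rot: "(\<lambda>w. f (u * w)) \<in> F" if "f \<in> F" "cmod u = 1" for f u
  proof -
    have "(f \<circ> (\<lambda>w. u * w)) holomorphic_on UNIV"
      using that by (intro holomorphic_on_compose holomorphic_intros)
        (auto simp: F_def intro: holomorphic_on_subset)
    moreover have "cmod (f (u * w)) \<le> \<omega> (cmod w)" for w
      using that by (auto simp: F_def norm_mult dest: spec[of _ "u * w"])
    ultimately show ?thesis
      by (auto simp: F_def o_def)
  qed
  have sub: "(\<lambda>f. cmod (f a)) ` F \<subseteq> (\<lambda>f. cmod (f b)) ` F" if "a = u * b" "cmod u = 1" for a b u
    using rot[OF _ that(2)] that(1) by (force simp: image_iff)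
  define u where "u = (if z = 0 then 1 else sgn z)"
  have u: "cmod u = 1" "cmod (inverse u) = 1"
    by (auto simp: u_def norm_sgn norm_inverse)
  have z: "z = u * of_real (cmod z)"
    by (auto simp: u_def sgn_eq)
  then have z': "of_real (cmod z) = inverse u * z"
    using u by (metis left_inverse mult.assoc mult_1 norm_zero zero_neq_one)
  have "(\<lambda>f. cmod (f (of_real (cmod z)))) ` F = (\<lambda>f. cmod (f z)) ` F"
    using sub[OF z u(1)] sub[OF z' u(2)] by blast
  then show ?thesis
    by (simp add: associated_weight_def F_def)
qed

definition Lq_space :: "real \<Rightarrow> 'a measure \<Rightarrow> ('a \<Rightarrow> complex) set" where
  "Lq_space q \<mu> = {f \<in> borel_measurable \<mu>. integrable \<mu> (\<lambda>x. norm (f x) powr q)}"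

definition Carleson_measure ::
  "real \<Rightarrow> (complex ^ 'd \<Rightarrow> complex) set \<Rightarrow> (complex ^ 'd) measure \<Rightarrow> bool" where
  "Carleson_measure q X \<mu> \<longleftrightarrow> X \<subseteq> Lq_space q \<mu>"

end

theory Submission
  imports Defs "HOL-Complex_Analysis.Complex_Analysis" "HOL-Probability.Probability"
    "HOL-Real_Asymp.Real_Asymp"
begin

text \<open>
  Let \<open>a n\<close> be the largest constant with \<open>a n * t ^ n \<le> \<omega> t\<close>. Cauchy's estimates together with the maximum
  principle on annuli between consecutive touching radii show that the associated weight is comparable
  to \<open>SUP n. a n * t ^ n\<close>. One can select degrees \<open>p k\<close> for which the supremum is still comparable to
  \<open>SUP k. a (p k) * t ^ p k\<close> and even to \<open>\<Sum>k. a (p k) * t ^ p k\<close>.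

  On the unit sphere of \<open>\<complex>\<^sup>d\<close> let the points \<open>\<xi>\<close> form a maximal family whose circles \<open>{u \<xi>. |u| = 1}\<close> are
  \<open>1 / sqrt n\<close>-separated. Then \<open>\<Sum>\<^sub>\<xi> |\<langle>z, \<xi>\<rangle>| ^ n\<close> is bounded independently of \<open>n\<close>, while some summand is
  at least \<open>1 / 2\<close>. Enumerating all terms \<open>a (p k) \<langle>z, \<xi>\<rangle> ^ p k\<close> as \<open>x m\<close>, every function
  \<open>f \<theta> = \<Sum>m. exp (2 \<pi> i m \<theta>) x m\<close> belongs to the growth space, and its mean modulus over \<open>\<theta> \<in> [0, 1]\<close>
  dominates each Fourier coefficient \<open>|x m|\<close>, hence the associated weight. If \<open>\<mu>\<close> is Carleson, then
  \<open>\<integral> |f \<theta>|\<^sup>q d\<mu> \<le> k\<close> on a set of \<open>\<theta>\<close> of measure near 1 for some \<open>k\<close>, and Fubini's theorem on this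
  set bounds the integral of the associated weight.
\<close>

section \<open>The largest monomials below a weight\<close>

text \<open>The quotient blows up at 0 because \<open>\<omega> 0 > 0\<close>, and at infinity
  because \<open>\<omega>\<close> outgrows every power, so a minimum over a suitable compact
  interval is global.\<close>

lemma weight_quotient_attains_min:
  assumes "weight_function \<omega>" "0 < n"
  shows "\<exists>s>0. \<forall>t>0. \<omega> s / s ^ n \<le> \<omega> t / t ^ n"
proof -
  have pos: "\<And>t. t \<ge> 0 \<Longrightarrow> \<omega> t > 0" and mono: "mono_on {0..} \<omega>" and cont: "continuous_on {0..} \<omega>"
    and lim: "filterlim (\<lambda>t. \<omega> t / t ^ n) at_top at_top"
    using assms by (auto simp: weight_function_def)
  obtain R where R: "\<And>t. t \<ge> R \<Longrightarrow> \<omega> 1 \<le> \<omega> t / t ^ n"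
    using lim unfolding filterlim_at_top eventually_at_top_linorder by blast
  \<comment> \<open>For \<open>0 < t \<le> r\<close> one has
    \<open>t ^ n \<le> t \<le> \<omega> 0 / \<omega> 1\<close>, so the quotient is at least
    \<open>\<omega> 1\<close>, its value at \<open>t = 1\<close>. The same benchmark determines
    \<open>R\<close>.\<close>
  define r where "r = min 1 (\<omega> 0 / \<omega> 1)"
  have r: "0 < r" "r \<le> 1"
    using pos[of 0] pos[of 1] by (auto simp: r_def)
  have small: "\<omega> 1 \<le> \<omega> t / t ^ n" if t: "0 < t" "t \<le> r" for t
  proof -
    have "t ^ n \<le> t ^ 1"
      using t r assms(2) by (intro power_decreasing) auto
    also have "t ^ 1 \<le> \<omega> 0 / \<omega> 1"
      using t by (auto simp: r_def)
    finally have "\<omega> 1 * t ^ n \<le> \<omega> 0"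
      using pos[of 1] by (simp add: field_simps)
    also have "\<omega> 0 \<le> \<omega> t"
      using mono t by (auto simp: mono_on_def)
    finally show ?thesis
      using t by (simp add: field_simps)
  qed
  have "continuous_on {r..max 1 R} (\<lambda>t. \<omega> t / t ^ n)"
    using r by (intro continuous_intros continuous_on_subset[OF cont]) auto
  then obtain s where s: "s \<in> {r..max 1 R}"
    "\<And>t. t \<in> {r..max 1 R} \<Longrightarrow> \<omega> s / s ^ n \<le> \<omega> t / t ^ n"
    using r continuous_attains_inf[of "{r..max 1 R}" "\<lambda>t. \<omega> t / t ^ n"] by fastforce
  have one: "\<omega> s / s ^ n \<le> \<omega> 1"
    using s(2)[of 1] r by auto
  have "\<omega> s / s ^ n \<le> \<omega> t / t ^ n" if "t > 0" for t
    using s(2)[of t] small[of t] R[of t] one that by fastforce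
  then show ?thesis
    using s(1) r by (intro exI[of _ s]) auto
qed

text \<open>\<open>a n\<close> is the minimum of \<open>\<omega> t / t ^ n\<close> and
  \<open>\<tau> n\<close> a radius where it is attained: the monomial of degree \<open>n\<close>
  touches the weight from below there. In degree 0 the minimum of the monotone weight sits at radius
  0.\<close>

locale touching_monomials =
  fixes \<omega> :: "real \<Rightarrow> real" and a \<tau> :: "nat \<Rightarrow> real"
  assumes weight_mono: "mono_on {0..} \<omega>"
    and coeff_pos: "0 < a n"
    and touch_nonneg: "0 \<le> \<tau> n"
    and touch_pos: "0 < n \<Longrightarrow> 0 < \<tau> n"
    and touch_zero: "\<tau> 0 = 0"
    and touch: "a n * \<tau> n ^ n = \<omega> (\<tau> n)"
    and monomial_le: "0 \<le> t \<Longrightarrow> a n * t ^ n \<le> \<omega> t"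

lemma ex_touching_monomials:
  assumes "weight_function \<omega>"
  shows "\<exists>a \<tau>. touching_monomials \<omega> a \<tau>"
proof -
  have pos: "\<And>t. t \<ge> 0 \<Longrightarrow> \<omega> t > 0" and mono: "mono_on {0..} \<omega>"
    using assms by (auto simp: weight_function_def)
  have "\<exists>s. 0 < n \<longrightarrow> (s > 0 \<and> (\<forall>t>0. \<omega> s / s ^ n \<le> \<omega> t / t ^ n))" for n
    using weight_quotient_attains_min[OF assms] by blast
  then obtain s where s: "\<And>n. 0 < n \<Longrightarrow> s n > 0"
    "\<And>n t. 0 < n \<Longrightarrow> t > 0 \<Longrightarrow> \<omega> (s n) / s n ^ n \<le> \<omega> t / t ^ n"
    by metis
  define \<tau> where "\<tau> n = (if n = 0 then 0 else s n)" for n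
  define a where "a n = (if n = 0 then \<omega> 0 else \<omega> (s n) / s n ^ n)" for n
  have "touching_monomials \<omega> a \<tau>"
  proof
    show "a n * t ^ n \<le> \<omega> t" if "0 \<le> t" for n t
    proof (cases "n = 0 \<or> t = 0")
      case True
      then show ?thesis
        using mono that pos[of 0] by (auto simp: a_def mono_on_def power_0_left)
    next
      case False
      then show ?thesis
        using s(2)[of n t] that by (simp add: a_def field_simps)
    qed
    show "a n * \<tau> n ^ n = \<omega> (\<tau> n)" for n
      using s(1)[of n] by (auto simp: a_def \<tau>_def)
    show "0 < a n" for n
      using pos[of "s n"] pos[of 0] s(1)[of n] by (auto simp: a_def)
  qed (use mono s(1) in \<open>auto simp: \<tau>_def less_imp_le\<close>)
  then show ?thesis
    by blast
qed

section \<open>Dependence of the monomials on the degree, and selection of degrees\<close>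

context touching_monomials
begin

definition T :: "nat \<Rightarrow> real \<Rightarrow> real" where
  "T n t = a n * t ^ n"

lemma T_nonneg: "0 \<le> t \<Longrightarrow> 0 \<le> T n t"
  using coeff_pos[of n] by (simp add: T_def)

lemma T_pos: "0 < t \<Longrightarrow> 0 < T n t"
  using coeff_pos[of n] by (simp add: T_def)

lemma T_le_weight: "0 \<le> t \<Longrightarrow> T n t \<le> \<omega> t"
  using monomial_le by (simp add: T_def)

lemma weight_le: "0 \<le> s \<Longrightarrow> s \<le> t \<Longrightarrow> \<omega> s \<le> \<omega> t"
  using weight_mono by (auto simp: mono_on_def)

lemma weight_zero_pos: "0 < \<omega> 0"
  using touch[of 0] coeff_pos[of 0] by (simp add: touch_zero)

text \<open>Comparison with the weight at \<open>2 * t\<close> instead of \<open>t\<close> gains a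
  factor \<open>2 ^ n\<close>, so for fixed \<open>t\<close> the monomials decay geometrically in
  the degree.\<close>

lemma T_le_power: "0 \<le> t \<Longrightarrow> T n t \<le> \<omega> (2 * t) / 2 ^ n"
  using monomial_le[of "2 * t" n] by (simp add: T_def power_mult_distrib field_simps)

lemma T_tendsto_0:
  assumes "0 \<le> t" shows "(\<lambda>n. T n t) \<longlonglongrightarrow> 0"
proof (rule tendsto_sandwich)
  show "eventually (\<lambda>n. 0 \<le> T n t) sequentially" "eventually (\<lambda>n. T n t \<le> \<omega> (2 * t) / 2 ^ n) sequentially"
    using assms T_nonneg T_le_power by auto
  show "(\<lambda>n. \<omega> (2 * t) / 2 ^ n) \<longlonglongrightarrow> 0"
    using LIMSEQ_power_zero[of "1/2 :: real"] tendsto_mult_left[of "\<lambda>n. (1/2::real)^n" 0 sequentially "\<omega> (2 * t)"]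
    by (simp add: power_divide field_simps)
qed auto

text \<open>At radius \<open>\<tau> j\<close> the monomial of degree \<open>j\<close> equals the
  weight and so dominates all others. Moving outward multiplies degree \<open>k\<close> by
  \<open>(t / \<tau> j) ^ k\<close>, which favours the higher degree \<open>j\<close>.\<close>

lemma T_le_of_touch_le:
  assumes "p \<le> j" "\<tau> j \<le> t"
  shows "T p t \<le> T j t"
proof (cases "\<tau> j = 0")
  case True
  then have "j = 0"
    using touch_pos[of j] by auto
  then show ?thesis
    using assms by auto
next
  case False
  then have tj: "\<tau> j > 0"
    using touch_nonneg[of j] by auto
  have eq: "t ^ k = (t / \<tau> j) ^ k * \<tau> j ^ k" for k
    using tj by (simp add: power_divide)
  have "T p t = (a p * \<tau> j ^ p) * (t / \<tau> j) ^ p"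
    unfolding T_def by (subst eq) simp
  also have "\<dots> \<le> (a j * \<tau> j ^ j) * (t / \<tau> j) ^ p"
    using monomial_le[of "\<tau> j" p] tj assms by (intro mult_right_mono) (auto simp: touch)
  also have "\<dots> \<le> (a j * \<tau> j ^ j) * (t / \<tau> j) ^ j"
    using tj assms coeff_pos[of j] by (intro mult_left_mono power_increasing) auto
  also have "\<dots> = T j t"
    unfolding T_def by (subst eq[of j]) simp
  finally show ?thesis .
qed

text \<open>The mirror image: moving inward from \<open>\<tau> j\<close> favours the lower
  degree.\<close>

lemma T_le_of_le_touch:
  assumes "j \<le> n" "t \<le> \<tau> j" "0 \<le> t"
  shows "T n t \<le> T j t"
proof (cases "\<tau> j = 0")
  case True
  then have "j = 0"
    using touch_pos[of j] by auto
  moreover have "t = 0"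
    using True assms by auto
  ultimately show ?thesis
    using coeff_pos[of 0] by (auto simp: T_def power_0_left)
next
  case False
  then have tj: "\<tau> j > 0"
    using touch_nonneg[of j] by auto
  have eq: "t ^ k = (t / \<tau> j) ^ k * \<tau> j ^ k" for k
    using tj by (simp add: power_divide)
  have "T n t = (a n * \<tau> j ^ n) * (t / \<tau> j) ^ n"
    unfolding T_def by (subst eq) simp
  also have "\<dots> \<le> (a j * \<tau> j ^ j) * (t / \<tau> j) ^ n"
    using monomial_le[of "\<tau> j" n] tj assms by (intro mult_right_mono) (auto simp: touch)
  also have "\<dots> \<le> (a j * \<tau> j ^ j) * (t / \<tau> j) ^ j"
    using tj assms coeff_pos[of j] by (intro mult_left_mono power_decreasing) auto
  also have "\<dots> = T j t"
    unfolding T_def by (subst eq[of j]) simp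
  finally show ?thesis .
qed

text \<open>Every \<open>t\<close> lies on one side of \<open>\<tau> j\<close>, so one of the two
  preceding comparisons applies. Thus, for fixed \<open>t\<close>, the values are unimodal in the
  degree.\<close>

lemma T_quasi_concave:
  assumes "p \<le> j" "j \<le> n" "0 \<le> t"
  shows "T p t \<le> T j t \<or> T n t \<le> T j t"
  using T_le_of_touch_le[of p j t] T_le_of_le_touch[of j n t] assms by linarith

text \<open>For \<open>t > 0\<close> the values are positive and tend to 0, so only finitely many
  degrees compete; at \<open>t = 0\<close> only degree 0 survives.\<close>

lemma ex_peak:
  assumes "0 \<le> t" shows "\<exists>K. \<forall>n. T n t \<le> T K t"
proof (cases "t = 0")
  case True
  have "T n 0 \<le> T 0 0" for n
    using coeff_pos[of 0] by (auto simp: T_def power_0_left)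
  with True show ?thesis by blast
next
  case False
  then have "T 0 t > 0"
    using assms by (intro T_pos) auto
  then obtain N where N: "\<And>n. n \<ge> N \<Longrightarrow> T n t < T 0 t"
    using order_tendstoD(2)[OF T_tendsto_0[OF assms]] by (auto simp: eventually_sequentially)
  obtain K where K: "K \<in> {..N}" "\<And>n. n \<in> {..N} \<Longrightarrow> T n t \<le> T K t"
    using Max_in[of "(\<lambda>n. T n t) ` {..N}"] Max_ge[of "(\<lambda>n. T n t) ` {..N}"] by fastforce
  have "T n t \<le> T K t" for n
    using K(2)[of n] K(2)[of 0] N[of n] by (cases "n \<le> N") auto
  then show ?thesis by blast
qed

text \<open>The quotient of the two monomials is a constant times \<open>t ^ (q - p)\<close>, so an
  inequality at \<open>s\<close> persists at larger radii; \<open>T_ratio_antimono\<close> is the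
  counterpart for smaller ones.\<close>

lemma T_ratio_mono:
  assumes "p \<le> q" "0 < s" "s \<le> t" "c * T p s < T q s" "0 \<le> c"
  shows "c * T p t < T q t"
proof -
  have eq: "t ^ k = (t / s) ^ k * s ^ k" for k
    using assms by (simp add: power_divide)
  have "c * T p t = (c * T p s) * (t / s) ^ p"
    unfolding T_def by (subst eq) simp
  also have "\<dots> < T q s * (t / s) ^ p"
    using assms by (intro mult_strict_right_mono) auto
  also have "\<dots> \<le> T q s * (t / s) ^ q"
    using assms T_nonneg[of s q] by (intro mult_left_mono power_increasing) auto
  also have "\<dots> = T q t"
    unfolding T_def by (subst eq[of q]) simp
  finally show ?thesis .
qed

lemma T_ratio_antimono:
  assumes "q \<le> n" "0 \<le> t" "t \<le> s" "0 < s" "c * T n s < T q s" "0 \<le> c"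
  shows "c * T n t \<le> T q t"
proof -
  have eq: "t ^ k = (t / s) ^ k * s ^ k" for k
    using assms by (simp add: power_divide)
  have "c * T n t = (c * T n s) * (t / s) ^ n"
    unfolding T_def by (subst eq) simp
  also have "\<dots> \<le> T q s * (t / s) ^ n"
    using assms by (intro mult_right_mono) auto
  also have "\<dots> \<le> T q s * (t / s) ^ q"
    using assms T_nonneg[of s q] by (intro mult_left_mono power_decreasing) auto
  also have "\<dots> = T q t"
    unfolding T_def by (subst eq[of q]) simp
  finally show ?thesis .
qed

text \<open>If the degrees \<open>p\<close> and \<open>n\<close> are adjacent in a selection and \<open>n\<close> is not hidden from \<open>p\<close>, then dropping
  everything in between costs a factor of at most 2; if \<open>n\<close> is hidden, then the two monomials are
  never both close to the maximum, which is what makes the selected series decay geometrically.\<close>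

definition hidden :: "nat \<Rightarrow> nat \<Rightarrow> bool" where
  "hidden p n \<longleftrightarrow> (\<exists>j s. p < j \<and> j < n \<and> 0 < s \<and> 2 * T p s < T j s \<and> 2 * T n s < T j s)"

text \<open>The neighbour \<open>Suc p\<close> hides all distant degrees: at a fixed radius where it
  beats degree \<open>p\<close> by more than a factor 2, the monomials of high degree are as small
  as desired.\<close>

lemma eventually_hidden: "\<exists>N. \<forall>n\<ge>N. hidden p n"
proof -
  define s where "s = 1 + 2 * a p / a (Suc p)"
  have s: "s > 0" "2 * a p < a (Suc p) * s"
    using coeff_pos[of p] coeff_pos[of "Suc p"] by (auto simp: s_def field_simps add_pos_pos)
  then have 1: "2 * T p s < T (Suc p) s"
    by (simp add: T_def)
  have "T (Suc p) s / 2 > 0"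
    using T_pos[OF s(1), of "Suc p"] by auto
  then obtain N where N: "\<And>n. n \<ge> N \<Longrightarrow> T n s < T (Suc p) s / 2"
    using order_tendstoD(2)[OF T_tendsto_0[of s]] s by (fastforce simp: eventually_sequentially)
  show ?thesis
  proof (intro exI allI impI)
    fix n assume "n \<ge> max N (p + 2)"
    then show "hidden p n"
      using N[of n] s(1) 1 unfolding hidden_def by (intro exI[of _ "Suc p"] exI[of _ s]) auto
  qed
qed

text \<open>Greedy selection of the farthest degree that is not hidden. Consecutive selected degrees
  are then not hidden from each other, which limits the loss in between, while degrees two steps
  apart are, which forces decay. The set is finite by \<open>eventually_hidden\<close> and contains
  the successor of \<open>degrees k\<close>, since no degree lies strictly between the two.\<close>

primrec degrees :: "nat \<Rightarrow> nat" where
  "degrees 0 = 0"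
| "degrees (Suc k) = Max {n. degrees k < n \<and> \<not> hidden (degrees k) n}"

declare degrees.simps(2) [simp del]

lemma degrees_Suc:
  shows degrees_less: "degrees k < degrees (Suc k)"
    and not_hidden_degrees: "\<not> hidden (degrees k) (degrees (Suc k))"
    and hidden_degrees: "degrees (Suc k) < n \<Longrightarrow> hidden (degrees k) n"
proof -
  define A where "A = {n. degrees k < n \<and> \<not> hidden (degrees k) n}"
  obtain N where "\<And>n. n \<ge> N \<Longrightarrow> hidden (degrees k) n"
    using eventually_hidden by blast
  then have "A \<subseteq> {..<N}"
    by (auto simp: A_def not_le[symmetric])
  then have fin: "finite A"
    by (rule finite_subset) auto
  have "Suc (degrees k) \<in> A"
    by (auto simp: A_def hidden_def)
  then have "Max A \<in> A"
    using fin by (intro Max_in) auto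
  then show "degrees k < degrees (Suc k)" "\<not> hidden (degrees k) (degrees (Suc k))"
    by (auto simp: A_def degrees.simps(2))
  show "hidden (degrees k) n" if "degrees (Suc k) < n"
  proof (rule ccontr)
    assume "\<not> hidden (degrees k) n"
    with that \<open>degrees k < degrees (Suc k)\<close> have "n \<in> A"
      by (auto simp: A_def)
    then have "n \<le> Max A"
      using fin by simp
    with that show False
      by (simp add: A_def degrees.simps(2))
  qed
qed

lemma strict_mono_degrees: "strict_mono degrees"
  by (simp add: strict_mono_Suc_iff degrees_less)

text \<open>A degree \<open>n\<close> strictly between two consecutive selected degrees cannot
  exceed twice both of their monomials at \<open>t\<close>: otherwise \<open>n\<close> and
  \<open>t\<close> would witness that the upper one is hidden.\<close>

lemma T_le_degrees:
  assumes "0 < t"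
  shows "\<exists>k. T n t \<le> 2 * T (degrees k) t"
proof -
  have "\<exists>k. degrees k \<le> n \<and> n < degrees (Suc k)"
  proof -
    define k where "k = (LEAST k. n < degrees (Suc k))"
    have "n < degrees (Suc n)"
      using strict_mono_imp_increasing[OF strict_mono_degrees, of "Suc n"] by simp
    then have k: "n < degrees (Suc k)"
      unfolding k_def by (rule LeastI)
    have "degrees k \<le> n"
    proof (cases k)
      case (Suc l)
      then show ?thesis
        using not_less_Least[of l "\<lambda>k. n < degrees (Suc k)"] by (auto simp: k_def)
    qed auto
    with k show ?thesis by blast
  qed
  then obtain k where k: "degrees k \<le> n" "n < degrees (Suc k)"
    by blast
  show ?thesis
  proof (cases "n = degrees k")
    case True
    then show ?thesis
      using T_pos[OF assms, of n] by (intro exI[of _ k]) auto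
  next
    case False
    have "\<not> (2 * T (degrees k) t < T n t \<and> 2 * T (degrees (Suc k)) t < T n t)"
      using not_hidden_degrees[of k] False k assms unfolding hidden_def by force
    then show ?thesis
      by (meson not_less)
  qed
qed

text \<open>Let \<open>j\<close> and \<open>s\<close> witness that the degree two steps ahead is
  hidden. Depending on the side of \<open>s\<close> on which \<open>t\<close> lies, \<open>j\<close>
  beats the lower or the upper degree at \<open>t\<close>. Unimodality makes the degree closer to
  the peak \<open>K\<close> at least as large as \<open>j\<close>, which excludes one alternative
  and yields the doubling from the other.\<close>

lemma degrees_decay:
  assumes t: "0 < t" and peak: "\<And>n. T n t \<le> T K t"
  shows degrees_decay_left:
      "degrees (k + 2) \<le> K \<Longrightarrow> 2 * T (degrees k) t \<le> T (degrees (k + 2)) t"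
    and degrees_decay_right:
      "K \<le> degrees k \<Longrightarrow> 2 * T (degrees (k + 2)) t \<le> T (degrees k) t"
proof -
  have "hidden (degrees k) (degrees (k + 2))"
    using degrees_less[of "Suc k"] by (intro hidden_degrees) auto
  then obtain j s where j: "degrees k < j" "j < degrees (k + 2)" "0 < s"
    "2 * T (degrees k) s < T j s" "2 * T (degrees (k + 2)) s < T j s"
    unfolding hidden_def by blast
  have up: "2 * T (degrees k) t < T j t" if "s \<le> t"
    using T_ratio_mono[OF _ j(3) that j(4)] j(1) by simp
  have down: "2 * T (degrees (k + 2)) t \<le> T j t" if "t \<le> s"
    using T_ratio_antimono[OF _ _ that j(3) j(5)] j(2) t by simp
  show "2 * T (degrees k) t \<le> T (degrees (k + 2)) t" if "degrees (k + 2) \<le> K"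
  proof -
    have le: "T j t \<le> T (degrees (k + 2)) t"
      using T_quasi_concave[of j "degrees (k + 2)" K t] that j(2) t peak[of "degrees (k + 2)"] peak[of j]
      by (metis less_imp_le order_trans)
    show ?thesis
      using le up down T_pos[OF t, of "degrees (k + 2)"] by linarith
  qed
  show "2 * T (degrees (k + 2)) t \<le> T (degrees k) t" if "K \<le> degrees k"
  proof -
    have le: "T j t \<le> T (degrees k) t"
      using T_quasi_concave[of K "degrees k" j t] that j(1) t peak[of j]
      by (metis less_imp_le order_trans)
    show ?thesis
      using le up down T_pos[OF t, of "degrees k"] by linarith
  qed
qed

text \<open>Split at the first selected degree reaching the peak, and further into even and odd
  indices. By \<open>degrees_decay\<close> each of the four pieces is dominated by a geometric
  series with ratio 1/2 and largest term at most \<open>T K t\<close>, hence contributes at most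
  \<open>2 * T K t\<close>.\<close>

lemma sum_degrees_le:
  assumes t: "0 \<le> t" and peak: "\<And>n. T n t \<le> T K t"
  shows "(\<Sum>k<N. T (degrees k) t) \<le> 8 * T K t"
proof (cases "t = 0")
  case True
  have 0: "degrees k > 0" if "k > 0" for k
    using strict_mono_less[OF strict_mono_degrees, of 0 k] that by simp
  have "(\<Sum>k<N. T (degrees k) t) \<le> (\<Sum>k<Suc N. T (degrees k) t)"
    using t by (intro sum_mono2) (auto intro: T_nonneg)
  also have "\<dots> = (\<Sum>k\<in>{0}. T (degrees k) t)"
    using 0 True by (intro sum.mono_neutral_right) (auto simp: T_def)
  also have "\<dots> \<le> 8 * T K t"
    using peak[of "degrees 0"] T_nonneg[OF t, of K] by simp
  finally show ?thesis .
next
  case False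
  with t have t: "0 < t" by auto
  define S where "S k = T (degrees k) t" for k
  have S0: "S k \<ge> 0" and SK: "S k \<le> T K t" for k
    using T_pos[OF t] peak by (auto simp: S_def less_imp_le)
  define k0 where "k0 = (LEAST k. K \<le> degrees k)"
  have "K \<le> degrees K"
    using strict_mono_imp_increasing[OF strict_mono_degrees] .
  then have k0: "K \<le> degrees k0"
    unfolding k0_def by (rule LeastI)
  have right: "2 * S (k0 + k + 2) \<le> S (k0 + k)" for k
    unfolding S_def using k0 strict_mono_less_eq[OF strict_mono_degrees, of k0 "k0 + k"]
    by (intro degrees_decay_right[OF t peak]) auto
  have left: "2 * S k \<le> S (k + 2)" if "k + 2 < k0" for k
    unfolding S_def using not_less_Least[of "k + 2" "\<lambda>k. K \<le> degrees k"] that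
    by (intro degrees_decay_left[OF t peak]) (auto simp: k0_def)
  \<comment> \<open>The added terms are the remainders of the two interleaved geometric series; they
    let the induction close.\<close>
  have R: "(\<Sum>k<n. S (k0 + k)) + 2 * S (k0 + n) + 2 * S (k0 + n + 1) \<le> 2 * S k0 + 2 * S (k0 + 1)" for n
  proof (induction n)
    case (Suc n)
    then show ?case
      using right[of n] by simp
  qed auto
  have L: "(\<Sum>k<n. S k) \<le> S n + S (n + 1)" if "n + 1 < k0" for n
    using that
  proof (induction n)
    case (Suc n)
    then show ?case
      using left[of n] by simp
  qed (use S0 in auto)
  have L': "(\<Sum>k<k0. S k) \<le> 4 * T K t"
  proof -
    have nn: "T K t \<ge> 0"
      using S0 SK order_trans by blast
    consider "k0 = 0" | "k0 = 1" | m where "k0 = m + 2"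
      by (metis One_nat_def add_2_eq_Suc' not0_implies_Suc)
    then show ?thesis
    proof cases
      case 3
      then show ?thesis
        using L[of m] SK[of m] SK[of "m + 1"] by simp
    qed (use nn SK[of 0] in auto)
  qed
  have "(\<Sum>k<N. S k) \<le> (\<Sum>k<k0 + N. S k)"
    using S0 by (intro sum_mono2) auto
  also have "\<dots> = (\<Sum>k<k0. S k) + (\<Sum>k<N. S (k0 + k))"
    by (induction N) auto
  also have "\<dots> \<le> 8 * T K t"
    using L' R[of N] S0[of "k0 + N"] S0[of "k0 + N + 1"] SK[of k0] SK[of "k0 + 1"] by linarith
  finally show ?thesis
    by (simp add: S_def)
qed

text \<open>If all touching radii were at most \<open>t\<close>, every \<open>T n t\<close> would be
  at least \<open>T 0 t = \<omega> 0 > 0\<close>, contradicting the decay in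
  \<open>n\<close>.\<close>

lemma touch_unbounded: "\<exists>n. t < \<tau> n"
proof (rule ccontr)
  assume "\<not> ?thesis"
  then have le: "\<tau> n \<le> t" for n
    by (meson not_less)
  then have t: "t > 0"
    using touch_pos[of 1] less_le_trans by auto
  have "\<omega> 0 \<le> T n t" for n
    using T_le_of_touch_le[of 0 n t] le touch[of 0] by (simp add: T_def touch_zero)
  then have "\<omega> 0 \<le> 0"
    using T_tendsto_0[of t] t by (intro LIMSEQ_le_const) auto
  then show False
    using weight_zero_pos by simp
qed

text \<open>The first radius beyond \<open>t\<close> has a predecessor because
  \<open>\<tau> 0 = 0 \<le> t\<close>.\<close>

lemma touch_bracket:
  assumes "0 \<le> t"
  shows "\<exists>n. \<tau> n \<le> t \<and> t < \<tau> (Suc n)"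
proof -
  define m where "m = (LEAST n. t < \<tau> n)"
  have m: "t < \<tau> m"
    unfolding m_def using touch_unbounded LeastI_ex[of "\<lambda>n. t < \<tau> n"] by blast
  then obtain n where n: "m = Suc n"
    using assms touch_zero by (cases m) auto
  then have "\<tau> n \<le> t"
    using not_less_Least[of n "\<lambda>n. t < \<tau> n"] by (auto simp: m_def)
  with m n show ?thesis
    by auto
qed

end

section \<open>The associated weight and the largest monomials\<close>

text \<open>Maximum principle for \<open>f w / w ^ m\<close>, which is holomorphic on the annulus
  because 0 is excluded.\<close>

lemma norm_le_power_on_annulus:
  assumes f: "f holomorphic_on UNIV" and r: "0 < r"
    and inner: "\<And>w. cmod w = r \<Longrightarrow> cmod (f w) \<le> B * r ^ m"
    and outer: "\<And>w. cmod w = s \<Longrightarrow> cmod (f w) \<le> B * s ^ m"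
    and z: "r \<le> cmod z" "cmod z \<le> s"
  shows "cmod (f z) \<le> B * cmod z ^ m"
proof -
  define S where "S = cball 0 s - ball (0::complex) r"
  have S: "S = {w. r \<le> cmod w \<and> cmod w \<le> s}"
    by (auto simp: S_def)
  have "closed S"
    unfolding S_def by (intro closed_Diff) auto
  have nz: "w \<noteq> 0" if "w \<in> S" for w
    using that r by (auto simp: S)
  have hol: "(\<lambda>w. f w / w ^ m) holomorphic_on S"
    using nz by (intro holomorphic_intros holomorphic_on_subset[OF f]) auto
  have "cmod (f z / z ^ m) \<le> B"
  proof (rule maximum_modulus_frontier[of "\<lambda>w. f w / w ^ m" S])
    show "(\<lambda>w. f w / w ^ m) holomorphic_on interior S"
      using hol interior_subset by (rule holomorphic_on_subset)
    show "continuous_on (closure S) (\<lambda>w. f w / w ^ m)"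
      using hol \<open>closed S\<close> by (simp add: holomorphic_on_imp_continuous_on)
    show "bounded S"
      unfolding S_def by (meson bounded_cball bounded_subset Diff_subset)
    show "z \<in> S"
      using z by (simp add: S)
    show "cmod (f w / w ^ m) \<le> B" if w: "w \<in> frontier S" for w
    proof -
      have "w \<in> S"
        using w \<open>closed S\<close> by (simp add: frontier_def)
      \<comment> \<open>The open annulus lies in the interior of \<open>S\<close>, so only the two
        circles can meet the frontier.\<close>
      moreover have "w \<notin> {w. r < cmod w \<and> cmod w < s}"
      proof
        assume *: "w \<in> {w. r < cmod w \<and> cmod w < s}"
        have "open {w. r < cmod w \<and> cmod w < s}"
          by (intro open_Collect_conj open_Collect_less continuous_intros)
        then have "w \<in> interior S"
          using * by (intro interiorI[of "{w. r < cmod w \<and> cmod w < s}"]) (auto simp: S)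
        with w show False
          by (simp add: frontier_def)
      qed
      ultimately have "cmod w = r \<or> cmod w = s"
        by (auto simp: S)
      then have "cmod (f w) \<le> B * cmod w ^ m"
        using inner outer by auto
      then show ?thesis
        using nz[OF \<open>w \<in> S\<close>] by (simp add: norm_divide norm_power field_simps)
    qed
  qed
  moreover have "z \<noteq> 0"
    using z r by auto
  ultimately show ?thesis
    by (simp add: norm_divide norm_power field_simps)
qed

section \<open>Bounding the associated weight by a monomial\<close>

context touching_monomials
begin

context
  fixes f :: "complex \<Rightarrow> complex"
  assumes f: "f holomorphic_on UNIV" and f_le: "\<And>w. cmod (f w) \<le> \<omega> (cmod w)"
begin

text \<open>Cauchy's inequality on the circle of radius \<open>\<tau> k\<close>, where the weight is
  exactly \<open>a k * \<tau> k ^ k\<close>.\<close>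

lemma taylor_coeff_le: "cmod ((deriv ^^ k) f 0 / fact k) \<le> a k"
proof (cases "k = 0")
  case True
  then show ?thesis
    using f_le[of 0] touch[of 0] by (simp add: touch_zero)
next
  case False
  then have pos: "\<tau> k > 0"
    using touch_pos by simp
  have "cmod ((deriv ^^ k) f 0) \<le> fact k * \<omega> (\<tau> k) / \<tau> k ^ k"
  proof (rule Cauchy_inequality)
    show "continuous_on (cball 0 (\<tau> k)) f"
      using f holomorphic_on_imp_continuous_on continuous_on_subset by blast
    show "cmod (f x) \<le> \<omega> (\<tau> k)" if "cmod (0 - x) = \<tau> k" for x
      using f_le[of x] that by simp
  qed (use f pos holomorphic_on_subset in auto)
  also have "\<dots> = fact k * a k"
    using pos by (simp add: touch[symmetric])
  finally show ?thesis
    by (simp add: norm_divide field_simps)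
qed

text \<open>If \<open>t\<close> is within a factor 2 of one of the radii, the maximum principle
  compares \<open>f\<close> with a single power, and converting this power to the touching monomial
  costs at most 2. If \<open>t\<close> is far from both, the Taylor series is dominated by geometric
  series in both directions from degrees \<open>n\<close> and \<open>Suc n\<close>.\<close>

lemma norm_le_max_monomials:
  assumes t: "\<tau> n \<le> cmod z" "cmod z < \<tau> (Suc n)"
  shows "cmod (f z) \<le> 4 * max (T n (cmod z)) (T (Suc n) (cmod z))"
proof -
  define t where "t = cmod z"
  have t0: "0 \<le> t" "\<tau> n \<le> t" "t < \<tau> (Suc n)"
    using t by (auto simp: t_def)
  have nonneg: "0 \<le> T n t" "0 \<le> T (Suc n) t"
    using T_nonneg t0 by auto
  have pos: "\<tau> (Suc n) > 0"
    by (simp add: touch_pos)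
  have "\<tau> (Suc n) \<le> 2 * t \<or> (n > 0 \<and> t \<le> 2 * \<tau> n) \<or> (2 * \<tau> n \<le> t \<and> 2 * t \<le> \<tau> (Suc n))"
    using t0 touch_zero by (cases "n = 0") auto
  then consider (outer) "\<tau> (Suc n) \<le> 2 * t" | (inner) "n > 0" "t \<le> 2 * \<tau> n"
    | (middle) "2 * \<tau> n \<le> t" "2 * t \<le> \<tau> (Suc n)"
    by blast
  then show ?thesis
  proof cases
    case outer
    \<comment> \<open>The multiple of \<open>t ^ n\<close> that meets the weight at the outer
      radius; it also dominates the weight at the inner one. For \<open>n = 0\<close> there is no
      inner circle and monotonicity of the weight suffices.\<close>
    have "cmod (f z) \<le> a (Suc n) * \<tau> (Suc n) * t ^ n"
    proof (cases "n = 0")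
      case True
      have "cmod (f z) \<le> \<omega> (\<tau> 1)"
        using f_le[of z] weight_le[of t "\<tau> 1"] t0 True by (simp add: t_def)
      then show ?thesis
        using True touch[of 1] by simp
    next
      case False
      then have pos': "\<tau> n > 0"
        by (simp add: touch_pos)
      show ?thesis
        unfolding t_def
      proof (rule norm_le_power_on_annulus[OF f pos' _ _ t(1) less_imp_le[OF t(2)]])
        show "cmod (f w) \<le> a (Suc n) * \<tau> (Suc n) * \<tau> (Suc n) ^ n" if "cmod w = \<tau> (Suc n)" for w
          using f_le[of w] that touch[of "Suc n"] by (simp add: mult.assoc)
        show "cmod (f w) \<le> a (Suc n) * \<tau> (Suc n) * \<tau> n ^ n" if "cmod w = \<tau> n" for w
        proof -
          have "a n * \<tau> (Suc n) ^ n \<le> a (Suc n) * \<tau> (Suc n) * \<tau> (Suc n) ^ n"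
            using T_le_of_touch_le[of n "Suc n" "\<tau> (Suc n)"] by (simp add: T_def mult.assoc)
          then have "a n \<le> a (Suc n) * \<tau> (Suc n)"
            using pos by (simp only: mult_le_cancel_right zero_less_power)
          then have "a n * \<tau> n ^ n \<le> a (Suc n) * \<tau> (Suc n) * \<tau> n ^ n"
            using pos' by (intro mult_right_mono) auto
          then show ?thesis
            using f_le[of w] that touch[of n] by simp
        qed
      qed
    qed
    also have "\<dots> \<le> a (Suc n) * (2 * t) * t ^ n"
      using outer t0 coeff_pos[of "Suc n"] by (intro mult_right_mono mult_left_mono) auto
    also have "\<dots> = 2 * T (Suc n) t"
      by (simp add: T_def)
    finally show ?thesis
      using nonneg unfolding t_def by linarith
  next
    case inner
    then have pos': "\<tau> n > 0"
      by (simp add: touch_pos)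
    \<comment> \<open>Dually, the multiple of \<open>t ^ Suc n\<close> that meets the weight at the
      inner radius.\<close>
    have "cmod (f z) \<le> a n / \<tau> n * t ^ Suc n"
      unfolding t_def
    proof (rule norm_le_power_on_annulus[OF f pos' _ _ t(1) less_imp_le[OF t(2)]])
      show "cmod (f w) \<le> a n / \<tau> n * \<tau> n ^ Suc n" if "cmod w = \<tau> n" for w
        using f_le[of w] that pos' touch[of n] by simp
      show "cmod (f w) \<le> a n / \<tau> n * \<tau> (Suc n) ^ Suc n" if "cmod w = \<tau> (Suc n)" for w
      proof -
        have "a (Suc n) * \<tau> n * \<tau> n ^ n \<le> a n * \<tau> n ^ n"
          using monomial_le[of "\<tau> n" "Suc n"] touch[of n] pos' by (simp add: mult.assoc)
        then have "a (Suc n) * \<tau> n \<le> a n"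
          using pos' by (simp only: mult_le_cancel_right zero_less_power)
        then have "a (Suc n) \<le> a n / \<tau> n"
          using pos' by (simp add: field_simps)
        then have "a (Suc n) * \<tau> (Suc n) ^ Suc n \<le> a n / \<tau> n * \<tau> (Suc n) ^ Suc n"
          using pos by (intro mult_right_mono) auto
        then show ?thesis
          using f_le[of w] that touch[of "Suc n"] by simp
      qed
    qed
    also have "\<dots> = (a n * t ^ n) * (t / \<tau> n)"
      by simp
    also have "\<dots> \<le> (a n * t ^ n) * 2"
      using inner pos' t0 coeff_pos[of n] by (intro mult_left_mono) (auto simp: field_simps)
    finally show ?thesis
      using nonneg unfolding t_def T_def by linarith
  next
    case middle
    have scale: "T k (c * t) = c ^ k * T k t" for k c
      by (simp add: T_def power_mult_distrib)
    \<comment> \<open>Degree \<open>n\<close> still dominates the lower degrees at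
      \<open>t / 2\<close>, and \<open>Suc n\<close> the higher ones at \<open>2 * t\<close>;
      rescaling to \<open>t\<close> turns this slack into powers of 2.\<close>
    have low: "T k t \<le> T n t * (2 ^ k / 2 ^ n)" if "k \<le> n" for k
      using T_le_of_touch_le[OF that, of "1/2 * t"] middle unfolding scale
      by (simp add: power_one_over field_simps)
    have high: "T (Suc n + k) t \<le> T (Suc n) t / 2 ^ k" for k
      using T_le_of_le_touch[of "Suc n" "Suc n + k" "2 * t"] middle t0 unfolding scale
      by (simp add: power_add field_simps)
    have L: "(\<Sum>k<N. T k t) \<le> T n t * (2 ^ N / 2 ^ n)" if "N \<le> Suc n" for N
      using that
    proof (induction N)
      case (Suc N)
      then show ?case
        using low[of N] by (simp add: field_simps)
    qed (use nonneg in auto)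
    have R: "(\<Sum>k<M. T (Suc n + k) t) + 2 * T (Suc n) t / 2 ^ M \<le> 2 * T (Suc n) t" for M
    proof (induction M)
      case (Suc M)
      then show ?case
        using high[of M] by (simp add: field_simps)
    qed auto
    have sum_le: "(\<Sum>k<N. T k t) \<le> 2 * T n t + 2 * T (Suc n) t" for N
    proof -
      have "(\<Sum>k<N. T k t) \<le> (\<Sum>k<Suc n + N. T k t)"
        using T_nonneg[OF t0(1)] by (intro sum_mono2) auto
      also have "\<dots> = (\<Sum>k<Suc n. T k t) + (\<Sum>k<N. T (Suc n + k) t)"
        by (induction N) auto
      also have "\<dots> \<le> 2 * T n t + 2 * T (Suc n) t"
      proof -
        have "0 \<le> 2 * T (Suc n) t / 2 ^ N"
          using nonneg by simp
        moreover have "(\<Sum>k<Suc n. T k t) \<le> 2 * T n t"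
          using L[of "Suc n"] by (simp del: sum.lessThan_Suc)
        ultimately show ?thesis
          using R[of N] by linarith
      qed
      finally show ?thesis .
    qed
    have "(\<lambda>k. (deriv ^^ k) f 0 / fact k * (z - 0) ^ k) sums f z"
      using f by (intro holomorphic_power_series[of f 0 "cmod z + 1"]) (auto intro: holomorphic_on_subset)
    then have "(\<lambda>N. cmod (\<Sum>k<N. (deriv ^^ k) f 0 / fact k * z ^ k)) \<longlonglongrightarrow> cmod (f z)"
      unfolding sums_def by (intro tendsto_norm) simp
    moreover have "cmod (\<Sum>k<N. (deriv ^^ k) f 0 / fact k * z ^ k) \<le> 2 * T n t + 2 * T (Suc n) t" for N
    proof -
      have "cmod (\<Sum>k<N. (deriv ^^ k) f 0 / fact k * z ^ k)
          \<le> (\<Sum>k<N. cmod ((deriv ^^ k) f 0 / fact k * z ^ k))"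
        by (rule norm_sum)
      also have "\<dots> \<le> (\<Sum>k<N. T k t)"
        unfolding T_def t_def norm_mult norm_power
        by (intro sum_mono mult_right_mono taylor_coeff_le) auto
      also note sum_le
      finally show ?thesis .
    qed
    ultimately have "cmod (f z) \<le> 2 * T n t + 2 * T (Suc n) t"
      by (intro LIMSEQ_le_const2) auto
    then show ?thesis
      unfolding t_def by linarith
  qed
qed

end

lemma associated_weight_nonempty:
  "(\<lambda>_. 0) \<in> {f. f holomorphic_on UNIV \<and> (\<forall>w. cmod (f w) \<le> \<omega> (cmod w))}"
proof -
  have "0 \<le> \<omega> (cmod w)" for w
    using weight_zero_pos weight_le[of 0 "cmod w"] by simp
  then show ?thesis
    by simp
qed

lemma le_associated_weight:
  assumes "f holomorphic_on UNIV" "\<And>w. cmod (f w) \<le> \<omega> (cmod w)"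
  shows "cmod (f z) \<le> associated_weight \<omega> (cmod z)"
  unfolding associated_weight_cmod
proof (rule cSUP_upper)
  show "bdd_above ((\<lambda>f. cmod (f z)) ` {f. f holomorphic_on UNIV \<and> (\<forall>w. cmod (f w) \<le> \<omega> (cmod w))})"
    by (rule bdd_aboveI[of _ "\<omega> (cmod z)"]) auto
qed (use assms in auto)

lemma associated_weight_nonneg:
  assumes "0 \<le> t" shows "0 \<le> associated_weight \<omega> t"
  using le_associated_weight[of "\<lambda>_. 0" "of_real t"] associated_weight_nonempty assms by simp

lemma associated_weight_le_monomial:
  assumes "0 \<le> t"
  shows "\<exists>n. associated_weight \<omega> t \<le> 4 * T n t"
proof -
  obtain n where n: "\<tau> n \<le> t" "t < \<tau> (Suc n)"
    using touch_bracket[OF assms] by blast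
  have "associated_weight \<omega> t \<le> 4 * max (T n t) (T (Suc n) t)"
    unfolding associated_weight_def
  proof (rule cSUP_least)
    fix f assume "f \<in> {f. f holomorphic_on UNIV \<and> (\<forall>w. cmod (f w) \<le> \<omega> (cmod w))}"
    then show "cmod (f (of_real t)) \<le> 4 * max (T n t) (T (Suc n) t)"
      using norm_le_max_monomials[of f n "of_real t"] n assms by auto
  qed (use associated_weight_nonempty in blast)
  then show ?thesis
    by (cases "T n t \<le> T (Suc n) t") (auto simp: max_def)
qed

end

section \<open>Separated points on the complex sphere\<close>

text \<open>Volume packing: the balls of radius \<open>s / 2\<close> about the points are disjoint
  and lie in a ball of radius \<open>R + s / 2\<close>.\<close>

lemma card_le_of_dist_ge:
  fixes Y :: "'a::euclidean_space set"
  assumes "finite Y" "Y \<subseteq> cball z R" "0 \<le> R" "0 < s"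
    and sep: "\<And>x y. x \<in> Y \<Longrightarrow> y \<in> Y \<Longrightarrow> x \<noteq> y \<Longrightarrow> s \<le> dist x y"
  shows "real (card Y) \<le> (1 + 2 * R / s) ^ DIM('a)"
proof -
  let ?V = "unit_ball_vol (real DIM('a))"
  have disj: "disjoint_family_on (\<lambda>y. ball y (s / 2)) Y"
    unfolding disjoint_family_on_def
  proof (intro ballI impI)
    fix x y assume "x \<in> Y" "y \<in> Y" "x \<noteq> y"
    then have "s \<le> dist x y"
      by (rule sep)
    then show "ball x (s / 2) \<inter> ball y (s / 2) = {}"
      by (intro disjoint_ballI) auto
  qed
  have "real (card Y) * (?V * (s / 2) ^ DIM('a)) = (\<Sum>y\<in>Y. measure lborel (ball y (s / 2)))"
    using \<open>0 < s\<close> by (simp add: content_ball)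
  also have "\<dots> = measure lborel (\<Union>y\<in>Y. ball y (s / 2))"
    using assms(1) disj by (intro measure_finite_Union[symmetric]) (auto simp: emeasure_ball \<open>0 < s\<close> less_imp_le)
  also have "\<dots> \<le> measure lborel (ball z (R + s / 2))"
  proof (rule measure_mono_fmeasurable)
    show "(\<Union>y\<in>Y. ball y (s / 2)) \<subseteq> ball z (R + s / 2)"
    proof safe
      fix y x assume "y \<in> Y" "x \<in> ball y (s / 2)"
      then show "x \<in> ball z (R + s / 2)"
        using assms(2) dist_triangle[of z x y] by auto
    qed
    show "(\<Union>y\<in>Y. ball y (s / 2)) \<in> sets lborel"
      using borel_open[OF open_UN[of Y "\<lambda>y. ball y (s / 2)"]] by simp
    show "ball z (R + s / 2) \<in> fmeasurable lborel"
      using emeasure_lborel_ball_finite[of z "R + s / 2"] by (intro fmeasurableI) auto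
  qed
  also have "\<dots> = ?V * (R + s / 2) ^ DIM('a)"
    using assms by (simp add: content_ball)
  finally have "?V * (real (card Y) * (s / 2) ^ DIM('a)) \<le> ?V * (R + s / 2) ^ DIM('a)"
    by (simp add: mult_ac)
  then have "real (card Y) * (s / 2) ^ DIM('a) \<le> (R + s / 2) ^ DIM('a)"
    by (rule mult_left_le_imp_le) simp
  then have "real (card Y) \<le> (R + s / 2) ^ DIM('a) / (s / 2) ^ DIM('a)"
    using \<open>0 < s\<close> by (simp add: pos_le_divide_eq)
  also have "\<dots> = ((R + s / 2) / (s / 2)) ^ DIM('a)"
    by (simp only: power_divide)
  also have "(R + s / 2) / (s / 2) = 1 + 2 * R / s"
    using \<open>0 < s\<close> by (simp add: field_simps)
  finally show ?thesis .
qed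

text \<open>The Hermitian product, conjugate linear in the second argument so that powers of
  \<open>hprod z w\<close> are holomorphic polynomials in \<open>z\<close>.\<close>

definition hprod :: "complex ^ 'd \<Rightarrow> complex ^ 'd \<Rightarrow> complex" where
  "hprod z w = (\<Sum>i\<in>UNIV. z $ i * cnj (w $ i))"

lemma hprod_scale_left: "hprod (c *s z) w = c * hprod z w"
  by (simp add: hprod_def sum_distrib_left mult_ac)

lemma hprod_scale_right: "hprod z (c *s w) = cnj c * hprod z w"
  by (simp add: hprod_def sum_distrib_left mult_ac)

lemma scaleR_eq_smult: "r *\<^sub>R z = complex_of_real r *s (z :: complex ^ 'd)"
  by (simp add: vec_eq_iff scaleR_conv_of_real[where 'a = complex])

lemma bounded_linear_hprod: "bounded_linear (\<lambda>z. hprod z w)"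
proof -
  have "linear (\<lambda>z. hprod z w)"
    by (rule linearI)
      (auto simp: hprod_def sum.distrib ring_distribs scaleR_conv_of_real[where 'a = complex] sum_distrib_left mult_ac)
  then show ?thesis
    by (simp add: linear_conv_bounded_linear)
qed

lemma cnj_hprod: "cnj (hprod z w) = hprod w z"
  by (simp add: hprod_def mult_ac)

lemma Re_hprod: "Re (hprod z w) = inner z w"
  by (simp add: hprod_def inner_vec_def inner_complex_def)

lemma norm_smult: "norm (c *s (z :: complex ^ 'd)) = cmod c * norm z"
  by (simp add: norm_vec_def norm_mult L2_set_right_distrib)

text \<open>Rotating \<open>w\<close> by the phase of the product makes the product real and
  nonnegative; for unit vectors this selects the point of the circle of \<open>w\<close> closest to
  \<open>z\<close>.\<close>

lemma ex_hprod_phase: "\<exists>u. cmod u = 1 \<and> hprod z (u *s w) = of_real (cmod (hprod z w))"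
proof (cases "hprod z w = 0")
  case True
  then show ?thesis
    by (intro exI[of _ 1]) (simp add: hprod_scale_right)
next
  case False
  have "cnj (sgn h) * h = of_real (cmod h)" for h :: complex
    by (cases "h = 0") (auto simp: sgn_eq complex_norm_square[symmetric] power2_eq_square mult_ac)
  with False show ?thesis
    by (intro exI[of _ "sgn (hprod z w)"]) (simp add: hprod_scale_right norm_sgn)
qed

lemma norm_hprod_le: "cmod (hprod z w) \<le> norm z * norm w"
proof -
  obtain u where u: "cmod u = 1" "hprod z (u *s w) = of_real (cmod (hprod z w))"
    using ex_hprod_phase by blast
  then have "cmod (hprod z w) = inner z (u *s w)"
    by (metis Re_complex_of_real Re_hprod)
  also have "\<dots> \<le> norm z * norm (u *s w)"
    by (rule norm_cauchy_schwarz)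
  finally show ?thesis
    using u by (simp add: norm_smult)
qed

lemma dist_unit_vectors:
  fixes z w :: "complex ^ 'd"
  assumes "norm z = 1" "norm w = 1"
  shows "(dist z w)\<^sup>2 = 2 - 2 * Re (hprod z w)"
proof -
  have "(dist z w)\<^sup>2 = inner z z + inner w w - 2 * inner z w"
    by (simp add: dist_norm power2_norm_eq_inner inner_diff inner_commute)
  also have "\<dots> = 2 - 2 * Re (hprod z w)"
    using assms by (simp add: Re_hprod norm_eq_1)
  finally show ?thesis .
qed

lemma ex_unit_direction:
  fixes z :: "complex ^ 'd"
  shows "\<exists>y. norm y = 1 \<and> z = complex_of_real (norm z) *s y"
proof (cases "z = 0")
  case True
  then show ?thesis
    by (intro exI[of _ "axis undefined 1"]) (simp add: norm_axis_1)
next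
  case False
  then show ?thesis
    by (intro exI[of _ "sgn z"]) (simp add: norm_sgn scaleR_eq_smult[symmetric] sgn_div_norm)
qed

text \<open>The quantity \<open>sqrt (2 - 2 * cmod (hprod z w))\<close> is the distance between the circles \<open>{u *s z}\<close> and
  \<open>{u *s w}\<close>, \<open>cmod u = 1\<close>.\<close>

definition separated :: "real \<Rightarrow> (complex ^ 'd) set \<Rightarrow> bool" where
  "separated s X \<longleftrightarrow> (\<forall>x\<in>X. norm x = 1) \<and>
     (\<forall>x\<in>X. \<forall>y\<in>X. x \<noteq> y \<longrightarrow> cmod (hprod x y) \<le> 1 - s\<^sup>2 / 2)"

lemma separated_subset: "separated s X \<Longrightarrow> Y \<subseteq> X \<Longrightarrow> separated s Y"
  unfolding separated_def by blast

text \<open>Each point is rotated to the representative of its circle closest to \<open>z\<close>.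
  Separation survives because \<open>cmod (hprod x y)\<close> ignores phases, so the packing bound
  applies in real dimension \<open>2 * CARD('d)\<close>.\<close>

lemma card_separated_le:
  fixes X :: "(complex ^ 'd) set"
  assumes "finite X" "separated s X" "0 < s" "norm z = 1" "0 \<le> R"
    and near: "\<And>x. x \<in> X \<Longrightarrow> 1 - R\<^sup>2 / 2 \<le> cmod (hprod z x)"
  shows "real (card X) \<le> (1 + 2 * R / s) ^ (2 * CARD('d))"
proof -
  obtain u where u: "\<And>x. cmod (u x) = 1" "\<And>x. hprod z (u x *s x) = of_real (cmod (hprod z x))"
    using ex_hprod_phase[of z] by metis
  define g where "g x = u x *s x" for x
  have unit: "norm (g x) = 1" if "x \<in> X" for x
    using assms(2) that u by (auto simp: g_def norm_smult separated_def)
  have sep: "s \<le> dist (g x) (g y)" if "x \<in> X" "y \<in> X" "x \<noteq> y" for x y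
  proof -
    have "Re (hprod (g x) (g y)) \<le> cmod (hprod (g x) (g y))"
      by (rule complex_Re_le_cmod)
    also have "\<dots> = cmod (hprod x y)"
      using u by (simp add: g_def hprod_scale_left hprod_scale_right norm_mult)
    also have "\<dots> \<le> 1 - s\<^sup>2 / 2"
      using assms(2) that by (auto simp: separated_def)
    finally have "s\<^sup>2 \<le> (dist (g x) (g y))\<^sup>2"
      using dist_unit_vectors[OF unit[OF that(1)] unit[OF that(2)]] by simp
    then show ?thesis
      using \<open>0 < s\<close> by (simp add: power2_le_iff_abs_le)
  qed
  have inj: "inj_on g X"
    using sep \<open>0 < s\<close> by (force intro!: inj_onI)
  have "g ` X \<subseteq> cball z R"
  proof safe
    fix x assume x: "x \<in> X"
    have "(dist z (g x))\<^sup>2 \<le> R\<^sup>2"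
      using dist_unit_vectors[OF assms(4) unit[OF x]] u(2)[of x] near[OF x] by (simp add: g_def)
    then show "g x \<in> cball z R"
      using \<open>0 \<le> R\<close> by (simp add: power2_le_iff_abs_le)
  qed
  then have "real (card (g ` X)) \<le> (1 + 2 * R / s) ^ DIM(complex ^ 'd)"
    using assms sep by (intro card_le_of_dist_ge) auto
  then show ?thesis
    by (simp add: card_image[OF inj] mult.commute)
qed

lemma card_separated_le_crude:
  fixes X :: "(complex ^ 'd) set"
  assumes "finite X" "separated s X" "0 < s"
  shows "real (card X) \<le> (1 + 4 / s) ^ (2 * CARD('d))"
proof -
  have "norm (axis undefined 1 :: complex ^ 'd) = 1"
    by (simp add: norm_axis_1)
  \<comment> \<open>With \<open>R = 2\<close> the nearness condition reads
    \<open>-1 \<le> cmod (hprod z x)\<close>, so it excludes nothing.\<close>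
  moreover have "-1 \<le> cmod h" for h :: complex
    by (rule order_trans[of _ 0]) auto
  ultimately show ?thesis
    using card_separated_le[OF assms, of "axis undefined 1" 2] by simp
qed

text \<open>Sizes of separated families are bounded, so one of maximal size exists; a unit vector
  far from all its members could be added to it.\<close>

lemma ex_separated_net:
  assumes "0 < s"
  shows "\<exists>X :: (complex ^ 'd) set. finite X \<and> separated s X \<and>
    (\<forall>z. norm z = 1 \<longrightarrow> (\<exists>x\<in>X. 1 - s\<^sup>2 / 2 < cmod (hprod z x)))"
proof -
  define P where "P k \<longleftrightarrow> (\<exists>X :: (complex ^ 'd) set. finite X \<and> separated s X \<and> card X = k)" for k
  have "P 0"
    unfolding P_def by (intro exI[of _ "{}"]) (auto simp: separated_def)
  moreover have "k \<le> nat \<lfloor>(1 + 4 / s) ^ (2 * CARD('d))\<rfloor>" if "P k" for k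
    using that card_separated_le_crude[of _ s] assms unfolding P_def by (force simp: le_nat_floor)
  ultimately obtain k where k: "P k" "\<And>l. P l \<Longrightarrow> l \<le> k"
    using GreatestI_nat[of P 0] Greatest_le_nat[of P] by metis
  then obtain X :: "(complex ^ 'd) set" where X: "finite X" "separated s X" "card X = k"
    by (auto simp: P_def)
  have "\<exists>x\<in>X. 1 - s\<^sup>2 / 2 < cmod (hprod z x)" if z: "norm z = 1" for z
  proof (rule ccontr)
    assume "\<not> ?thesis"
    then have far: "cmod (hprod z x) \<le> 1 - s\<^sup>2 / 2" if "x \<in> X" for x
      using that by (auto simp: not_less)
    moreover have "hprod z z = of_real ((norm z)\<^sup>2)"
      by (rule complex_eqI) (use Re_hprod[of z z] cnj_hprod[of z z] in
          \<open>auto simp: power2_norm_eq_inner complex_eq_iff\<close>)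
    ultimately have "z \<notin> X"
      using z assms by fastforce
    have "cmod (hprod x z) \<le> 1 - s\<^sup>2 / 2" if "x \<in> X" for x
      using far[OF that] by (metis cnj_hprod complex_mod_cnj)
    then have "separated s (insert z X)"
      using X(2) z far by (auto simp: separated_def)
    then have "P (Suc k)"
      using X \<open>z \<notin> X\<close> unfolding P_def by (intro exI[of _ "insert z X"]) auto
    with k(2) show False
      by fastforce
  qed
  with X show ?thesis
    by blast
qed

text \<open>The points are sorted into shells by their distance from \<open>z\<close> in units of
  \<open>1 / sqrt n\<close>. Shell \<open>k\<close> holds polynomially many points by packing, and
  each contributes at most \<open>exp (- real k / 2)\<close>, so the total is independent of
  \<open>n\<close>.\<close>

lemma sum_hprod_power_le:
  fixes X :: "(complex ^ 'd) set"
  assumes X: "finite X" "separated (1 / sqrt n) X" and n: "0 < (n :: nat)" and z: "norm z = 1"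
  shows "(\<Sum>x\<in>X. cmod (hprod z x) ^ n) \<le> (\<Sum>k. (2 * real k + 3) ^ (2 * CARD('d)) * exp (- real k / 2))"
proof -
  let ?m = "2 * CARD('d)"
  \<comment> \<open>\<open>\<delta> x\<close> is the distance from \<open>z\<close> to the circle of
    \<open>x\<close>, and \<open>\<kappa> x\<close> below is the index of its shell.\<close>
  define \<delta> where "\<delta> x = sqrt (2 - 2 * cmod (hprod z x))" for x
  define \<kappa> where "\<kappa> x = nat \<lfloor>sqrt n * \<delta> x\<rfloor>" for x
  have hle: "cmod (hprod z x) \<le> 1" if "x \<in> X" for x
    using norm_hprod_le[of z x] X(2) z that by (auto simp: separated_def)
  have \<delta>: "0 \<le> \<delta> x" "(\<delta> x)\<^sup>2 = 2 - 2 * cmod (hprod z x)" if "x \<in> X" for x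
    using hle[OF that] by (auto simp: \<delta>_def)
  have \<kappa>: "real (\<kappa> x) \<le> sqrt n * \<delta> x" "sqrt n * \<delta> x \<le> real (\<kappa> x) + 1" if "x \<in> X" for x
  proof -
    have "0 \<le> sqrt n * \<delta> x"
      using \<delta>(1)[OF that] by simp
    then show "real (\<kappa> x) \<le> sqrt n * \<delta> x" "sqrt n * \<delta> x \<le> real (\<kappa> x) + 1"
      unfolding \<kappa>_def by linarith+
  qed
  have term_le: "cmod (hprod z x) ^ n \<le> exp (- real (\<kappa> x) / 2)" if "x \<in> X" for x
  proof -
    have "cmod (hprod z x) = 1 + - ((\<delta> x)\<^sup>2 / 2)"
      using \<delta>(2)[OF that] by (simp add: field_simps)
    also have "\<dots> \<le> exp (- ((\<delta> x)\<^sup>2 / 2))"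
      by (rule exp_ge_add_one_self)
    finally have "cmod (hprod z x) ^ n \<le> exp (- ((\<delta> x)\<^sup>2 / 2)) ^ n"
      by (intro power_mono) auto
    also have "\<dots> = exp (- ((sqrt n * \<delta> x)\<^sup>2 / 2))"
      by (simp add: exp_of_nat_mult[symmetric] power_mult_distrib)
    also have "\<dots> \<le> exp (- real (\<kappa> x) / 2)"
    proof -
      have "real (\<kappa> x) \<le> (real (\<kappa> x))\<^sup>2"
        by (cases "\<kappa> x") (auto simp: power2_eq_square)
      also have "\<dots> \<le> (sqrt n * \<delta> x)\<^sup>2"
        using \<kappa>(1)[OF that] by (intro power_mono) auto
      finally show ?thesis
        by simp
    qed
    finally show ?thesis .
  qed
  have count: "real (card {x\<in>X. \<kappa> x = k}) \<le> (2 * real k + 3) ^ ?m" for k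
  proof -
    have "real (card {x\<in>X. \<kappa> x = k}) \<le> (1 + 2 * ((real k + 1) / sqrt n) / (1 / sqrt n)) ^ ?m"
    proof (rule card_separated_le)
      show "separated (1 / sqrt n) {x\<in>X. \<kappa> x = k}"
        using X(2) by (rule separated_subset) auto
      fix x assume x: "x \<in> {x\<in>X. \<kappa> x = k}"
      then have "\<delta> x \<le> (real k + 1) / sqrt n"
        using \<kappa>(2)[of x] n by (auto simp: field_simps)
      then have "(\<delta> x)\<^sup>2 \<le> ((real k + 1) / sqrt n)\<^sup>2"
        using \<delta>(1) x by (intro power_mono) auto
      then show "1 - ((real k + 1) / sqrt n)\<^sup>2 / 2 \<le> cmod (hprod z x)"
        using \<delta>(2)[of x] x by auto
    qed (use X n z in auto)
    also have "1 + 2 * ((real k + 1) / sqrt n) / (1 / sqrt n) = 2 * real k + 3"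
      using n by (simp add: field_simps)
    finally show ?thesis .
  qed
  have "(\<Sum>x\<in>X. cmod (hprod z x) ^ n) \<le> (\<Sum>x\<in>X. exp (- real (\<kappa> x) / 2))"
    by (intro sum_mono term_le)
  also have "\<dots> = (\<Sum>k\<in>\<kappa> ` X. \<Sum>x\<in>{x\<in>X. \<kappa> x = k}. exp (- real (\<kappa> x) / 2))"
    using X(1) by (rule sum.image_gen)
  also have "\<dots> \<le> (\<Sum>k\<in>\<kappa> ` X. (2 * real k + 3) ^ ?m * exp (- real k / 2))"
    using count by (intro sum_mono) (simp add: mult_right_mono)
  also have "\<dots> \<le> (\<Sum>k. (2 * real k + 3) ^ ?m * exp (- real k / 2))"
  proof (rule sum_le_suminf)
    have "(\<lambda>k. (2 * real k + 3) ^ ?m * exp (- real k / 2)) \<in> O(\<lambda>k. 1 / real k ^ 2)"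
      by real_asymp
    then show "summable (\<lambda>k. (2 * real k + 3) ^ ?m * exp (- real k / 2))"
      by (rule summable_comparison_test_bigo[rotated]) (simp add: inverse_power_summable[of 2, unfolded inverse_eq_divide])
  qed (use X in auto)
  finally show ?thesis .
qed

text \<open>Homogeneity reduces both estimates to unit vectors, where a net at scale
  \<open>1 / sqrt n\<close> works. Degree 0 admits no such scale and is served by one arbitrary
  vector. The polynomial bound on the cardinality later gives convergence of the differentiated
  series.\<close>

lemma ex_homogeneous_family:
  "\<exists>C>0. \<forall>n. \<exists>X :: (complex ^ 'd) set. finite X \<and> (\<forall>x\<in>X. norm x = 1) \<and>
     real (card X) \<le> (5 + 4 * real n) ^ (2 * CARD('d)) \<and>
     (\<forall>z. (\<Sum>x\<in>X. cmod (hprod z x) ^ n) \<le> C * norm z ^ n) \<and>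
     (\<forall>z. \<exists>x\<in>X. norm z ^ n \<le> 2 * cmod (hprod z x) ^ n)"
proof -
  define C where "C = max 1 (\<Sum>k. (2 * real k + 3) ^ (2 * CARD('d)) * exp (- real k / 2))"
  have "\<exists>X :: (complex ^ 'd) set. finite X \<and> (\<forall>x\<in>X. norm x = 1) \<and>
     real (card X) \<le> (5 + 4 * real n) ^ (2 * CARD('d)) \<and>
     (\<forall>z. (\<Sum>x\<in>X. cmod (hprod z x) ^ n) \<le> C * norm z ^ n) \<and>
     (\<forall>z. \<exists>x\<in>X. norm z ^ n \<le> 2 * cmod (hprod z x) ^ n)" for n
  proof (cases "n = 0")
    case True
    have "norm (axis undefined 1 :: complex ^ 'd) = 1"
      by (simp add: norm_axis_1)
    with True show ?thesis
      by (intro exI[of _ "{axis undefined 1}"]) (auto simp: C_def)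
  next
    case False
    define s where "s = 1 / sqrt n"
    have s: "s > 0" "s\<^sup>2 = 1 / n" "s\<^sup>2 \<le> 1"
      using False by (auto simp: s_def power_divide)
    obtain X :: "(complex ^ 'd) set" where X: "finite X" "separated s X"
      "\<And>z. norm z = 1 \<Longrightarrow> \<exists>x\<in>X. 1 - s\<^sup>2 / 2 < cmod (hprod z x)"
      using ex_separated_net[OF s(1)] by blast
    have "real (card X) \<le> (1 + 4 / s) ^ (2 * CARD('d))"
      by (rule card_separated_le_crude[OF X(1,2) s(1)])
    also have "\<dots> \<le> (5 + 4 * real n) ^ (2 * CARD('d))"
    proof (rule power_mono)
      have "sqrt n \<le> real n"
        using False real_le_lsqrt[of "real n" "real n"] by (simp add: power2_eq_square)
      then show "1 + 4 / s \<le> 5 + 4 * real n"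
        using False by (simp add: s_def)
    qed (use s in auto)
    finally have card: "real (card X) \<le> (5 + 4 * real n) ^ (2 * CARD('d))" .
    have upper: "(\<Sum>x\<in>X. cmod (hprod z x) ^ n) \<le> C * norm z ^ n" for z
    proof -
      obtain y where y: "norm y = 1" "z = complex_of_real (norm z) *s y"
        using ex_unit_direction by blast
      have "(\<Sum>x\<in>X. cmod (hprod z x) ^ n) = norm z ^ n * (\<Sum>x\<in>X. cmod (hprod y x) ^ n)"
        by (subst y(2)) (simp add: hprod_scale_left norm_mult power_mult_distrib sum_distrib_left)
      also have "\<dots> \<le> norm z ^ n * C"
        using sum_hprod_power_le[of X n y] X False y(1) unfolding C_def s_def
        by (intro mult_left_mono) auto
      finally show ?thesis
        by (simp add: mult.commute)
    qed
    have lower: "\<exists>x\<in>X. norm z ^ n \<le> 2 * cmod (hprod z x) ^ n" for z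
    proof -
      obtain y where y: "norm y = 1" "z = complex_of_real (norm z) *s y"
        using ex_unit_direction by blast
      obtain x where x: "x \<in> X" "1 - s\<^sup>2 / 2 < cmod (hprod y x)"
        using X(3) y(1) by blast
      \<comment> \<open>The net guarantees a product above \<open>1 - 1 / (2 * n)\<close>, whose
        \<open>n\<close>-th power is at least \<open>1 / 2\<close> by Bernoulli's
        inequality.\<close>
      have "1 / 2 = 1 + real n * (- (s\<^sup>2 / 2))"
        using False s(2) by simp
      also have "\<dots> \<le> (1 + - (s\<^sup>2 / 2)) ^ n"
        using s(3) by (intro Bernoulli_inequality) simp
      also have "\<dots> \<le> cmod (hprod y x) ^ n"
        using x(2) s(3) by (intro power_mono) auto
      finally have "norm z ^ n * (1 / 2) \<le> norm z ^ n * cmod (hprod y x) ^ n"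
        by (rule mult_left_mono) auto
      also have "\<dots> = cmod (hprod z x) ^ n"
        unfolding arg_cong[OF y(2), of "\<lambda>w. hprod w x"]
        by (simp add: hprod_scale_left norm_mult power_mult_distrib)
      finally show ?thesis
        using x(1) by (intro bexI[of _ x]) auto
    qed
    show ?thesis
      using X card upper lower by (intro exI[of _ X]) (auto simp: separated_def)
  qed
  then show ?thesis
    by (intro exI[of _ C]) (auto simp: C_def)
qed

section \<open>Integrability from a random family\<close>

text \<open>For fixed \<open>z\<close>, the pointwise bound and the lower bound on the mean force
  \<open>norm (f \<theta> z)\<close> to be comparable to \<open>g z\<close> on a set of
  \<open>\<theta>\<close> whose measure is bounded below. It must overlap a set \<open>A k\<close>
  of measure near 1 on which the integrals over \<open>N\<close> are at most \<open>k\<close>, and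
  Tonelli's theorem over \<open>A k\<close> concludes. Arguing with sets instead of convexity covers
  all \<open>q > 0\<close>.\<close>

lemma nn_integral_powr_finite_of_family:
  fixes f :: "'p \<Rightarrow> 'a \<Rightarrow> complex" and g :: "'a \<Rightarrow> real"
  assumes M: "prob_space M" and N: "finite_measure N"
    and meas[measurable]: "(\<lambda>x. f (fst x) (snd x)) \<in> borel_measurable (M \<Otimes>\<^sub>M N)"
    and fin: "\<And>\<theta>. \<theta> \<in> space M \<Longrightarrow> (\<integral>\<^sup>+ z. ennreal (norm (f \<theta> z) powr q) \<partial>N) < \<infinity>"
    and le: "\<And>\<theta> z. \<theta> \<in> space M \<Longrightarrow> z \<in> space N \<Longrightarrow> norm (f \<theta> z) \<le> B * g z"
    and ge: "\<And>z. z \<in> space N \<Longrightarrow> b * g z \<le> (\<integral>\<theta>. norm (f \<theta> z) \<partial>M)"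
    and g: "\<And>z. z \<in> space N \<Longrightarrow> 0 \<le> g z" and "0 < b" "0 < B" "0 < q"
  shows "(\<integral>\<^sup>+ z. ennreal (g z powr q) \<partial>N) < \<infinity>"
proof -
  interpret M: prob_space M by fact
  interpret N: finite_measure N by fact
  interpret P: pair_sigma_finite M N ..
  define I where "I \<theta> = (\<integral>\<^sup>+ z. ennreal (norm (f \<theta> z) powr q) \<partial>N)" for \<theta>
  have meas_I[measurable]: "I \<in> borel_measurable M"
    unfolding I_def by measurable
  define A where "A k = {\<theta>\<in>space M. I \<theta> \<le> of_nat k}" for k :: nat
  have A_sets[measurable]: "A k \<in> sets M" for k
    unfolding A_def by measurable
  have "(\<Union>k. A k) = space M"
  proof safe
    fix \<theta> assume \<theta>: "\<theta> \<in> space M"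
    then obtain k where "I \<theta> < of_nat k"
      using fin[OF \<theta>] ennreal_Ex_less_of_nat[of "I \<theta>"] by (auto simp: I_def)
    with \<theta> show "\<theta> \<in> (\<Union>k. A k)"
      by (auto simp: A_def intro!: exI[of _ k] less_imp_le)
  qed (auto simp: A_def)
  moreover have "incseq A"
    by (auto simp: incseq_def A_def intro: order_trans)
  moreover have "range A \<subseteq> sets M"
    by auto
  ultimately have "(\<lambda>k. M.prob (A k)) \<longlonglongrightarrow> 1"
    using M.finite_Lim_measure_incseq[of A] by (simp add: M.prob_space)
  moreover have "1 - b / (4 * B) < 1"
    using \<open>0 < b\<close> \<open>0 < B\<close> by simp
  ultimately obtain k where k: "1 - b / (4 * B) < M.prob (A k)"
    by (metis (no_types, lifting) order_tendstoD(1) eventually_sequentially order_refl)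
  define J where "J z = (\<integral>\<^sup>+ \<theta>. indicator (A k) \<theta> * ennreal (norm (f \<theta> z) powr q) \<partial>M)" for z
  define c where "c = (b / 2) powr q * (b / (4 * B))"
  have "c > 0"
    using \<open>0 < b\<close> \<open>0 < B\<close> by (simp add: c_def)
  have key: "ennreal c * ennreal (g z powr q) \<le> J z" if z: "z \<in> space N" for z
  proof (cases "g z = 0")
    case True
    then show ?thesis
      by simp
  next
    case False
    with g[OF z] have gz: "g z > 0"
      by simp
    have [measurable]: "(\<lambda>\<theta>. f \<theta> z) \<in> borel_measurable M"
      using measurable_compose[OF measurable_Pair2'[OF z, of M] meas] by simp
    define D where "D = {\<theta>\<in>space M. b / 2 * g z \<le> norm (f \<theta> z)}"
    have [measurable]: "D \<in> sets M"
      unfolding D_def by measurable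
    have "b * g z \<le> (\<integral>\<theta>. norm (f \<theta> z) \<partial>M)"
      by (rule ge[OF z])
    \<comment> \<open>Off \<open>D\<close> the modulus is below half of the lower bound for the
      mean, so \<open>D\<close> must have measure at least \<open>b / (2 * B)\<close>.\<close>
    also have "\<dots> \<le> (\<integral>\<theta>. b / 2 * g z + B * g z * indicator D \<theta> \<partial>M)"
    proof (rule integral_mono')
      show "integrable M (\<lambda>\<theta>. b / 2 * g z + B * g z * indicator D \<theta>)"
        by (intro Bochner_Integration.integrable_add integrable_mult_right)
          (auto simp: M.emeasure_eq_measure)
      show "norm (f \<theta> z) \<le> b / 2 * g z + B * g z * indicator D \<theta>" if "\<theta> \<in> space M" for \<theta>
        using le[OF that z] that mult_pos_pos[OF \<open>0 < b\<close> gz] by (auto simp: D_def indicator_def)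
    qed (use gz \<open>0 < b\<close> \<open>0 < B\<close> in auto)
    also have "\<dots> = b / 2 * g z + B * g z * M.prob D"
      by (subst Bochner_Integration.integral_add) (auto simp: M.prob_space M.emeasure_eq_measure)
    finally have "g z * (b / 2) \<le> g z * (B * M.prob D)"
      by (simp add: field_simps)
    then have "b / 2 \<le> B * M.prob D"
      using gz by (rule mult_left_le_imp_le)
    then have "b / (2 * B) \<le> M.prob D"
      using \<open>0 < B\<close> by (simp add: field_simps)
    moreover have "M.prob (A k \<union> D) = M.prob (A k) + M.prob D - M.prob (A k \<inter> D)"
      by (simp add: measure_Un3 M.fmeasurable_eq_sets)
    \<comment> \<open>At most half of this lower bound is lost to the complement of
      \<open>A k\<close>; the other half remains in \<open>A k \<inter> D\<close>.\<close>
    moreover have "b / (2 * B) = b / (4 * B) + b / (4 * B)"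
      by simp
    ultimately have "b / (4 * B) \<le> M.prob (A k \<inter> D)"
      using k M.prob_le_1[of "A k \<union> D"] by linarith
    then have "(b / 2 * g z) powr q * (b / (4 * B)) \<le> (b / 2 * g z) powr q * M.prob (A k \<inter> D)"
      by (intro mult_left_mono) auto
    moreover have "c * g z powr q = (b / 2 * g z) powr q * (b / (4 * B))"
      unfolding c_def by (subst powr_mult) (use \<open>0 < b\<close> gz in \<open>auto simp: mult_ac\<close>)
    ultimately have "ennreal (c * g z powr q) \<le> ennreal ((b / 2 * g z) powr q * M.prob (A k \<inter> D))"
      by (intro ennreal_leI) simp
    then have "ennreal c * ennreal (g z powr q) \<le> ennreal ((b / 2 * g z) powr q) * emeasure M (A k \<inter> D)"
      using \<open>0 < c\<close> by (simp add: M.emeasure_eq_measure ennreal_mult)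
    also have "\<dots> = (\<integral>\<^sup>+ \<theta>. ennreal ((b / 2 * g z) powr q) * indicator (A k \<inter> D) \<theta> \<partial>M)"
      by (subst nn_integral_cmult_indicator) auto
    also have "\<dots> \<le> J z"
      unfolding J_def using \<open>0 < b\<close> \<open>0 < q\<close> gz
      by (intro nn_integral_mono) (auto simp: D_def indicator_def intro!: ennreal_leI powr_mono2)
    finally show ?thesis .
  qed
  have "ennreal c * (\<integral>\<^sup>+ z. ennreal (g z powr q) \<partial>N) \<le> (\<integral>\<^sup>+ z. J z \<partial>N)"
  proof -
    have [measurable]: "(\<lambda>x. f (snd x) (fst x)) \<in> borel_measurable (N \<Otimes>\<^sub>M M)"
      using measurable_compose[OF measurable_pair_swap' meas] by (simp add: case_prod_beta)
    have [measurable]: "J \<in> borel_measurable N"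
      unfolding J_def by measurable
    have "(\<integral>\<^sup>+ z. ennreal (g z powr q) \<partial>N) \<le> (\<integral>\<^sup>+ z. ennreal (1 / c) * J z \<partial>N)"
    proof (rule nn_integral_mono)
      fix z assume "z \<in> space N"
      then have "ennreal (1 / c) * (ennreal c * ennreal (g z powr q)) \<le> ennreal (1 / c) * J z"
        using key by (intro mult_left_mono) auto
      then show "ennreal (g z powr q) \<le> ennreal (1 / c) * J z"
        using \<open>c > 0\<close> by (simp add: mult.assoc[symmetric] ennreal_mult[symmetric])
    qed
    also have "\<dots> = ennreal (1 / c) * (\<integral>\<^sup>+ z. J z \<partial>N)"
      by (intro nn_integral_cmult) measurable
    finally have "ennreal c * (\<integral>\<^sup>+ z. ennreal (g z powr q) \<partial>N)
        \<le> ennreal c * (ennreal (1 / c) * (\<integral>\<^sup>+ z. J z \<partial>N))"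
      by (rule mult_left_mono) auto
    then show ?thesis
      using \<open>c > 0\<close> by (simp add: mult.assoc[symmetric] ennreal_mult[symmetric])
  qed
  also have "(\<integral>\<^sup>+ z. J z \<partial>N) = (\<integral>\<^sup>+ \<theta>. (\<integral>\<^sup>+ z. indicator (A k) \<theta> * ennreal (norm (f \<theta> z) powr q) \<partial>N) \<partial>M)"
    unfolding J_def
    using P.Fubini[of "\<lambda>x. indicator (A k) (fst x) * ennreal (norm (f (fst x) (snd x)) powr q)"] by simp
  also have "\<dots> \<le> (\<integral>\<^sup>+ \<theta>. of_nat k \<partial>M)"
  proof (rule nn_integral_mono)
    fix \<theta> assume "\<theta> \<in> space M"
    show "(\<integral>\<^sup>+ z. indicator (A k) \<theta> * ennreal (norm (f \<theta> z) powr q) \<partial>N) \<le> of_nat k"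
      by (auto simp: indicator_def A_def I_def)
  qed
  also have "\<dots> < \<infinity>"
    by (simp add: M.emeasure_space_1 of_nat_less_top)
  finally show ?thesis
    using \<open>c > 0\<close> by (auto simp: ennreal_mult_less_top)
qed

section \<open>Series with random phases\<close>

abbreviation unit_interval :: "real measure" where
  "unit_interval \<equiv> restrict_space lborel {0..1}"

lemma prob_space_unit_interval: "prob_space unit_interval"
  by (rule prob_space_restrict_space) auto

lemma integral_cis:
  "(\<integral>\<theta>. cis (2 * pi * real_of_int k * \<theta>) \<partial>unit_interval) = (if k = 0 then 1 else 0)"
proof (cases "k = 0")
  case True
  then show ?thesis
    using prob_space.prob_space[OF prob_space_unit_interval] by simp
next
  case False
  define F where "F \<theta> = cis (2 * pi * real_of_int k * \<theta>) / (\<i> * of_real (2 * pi * real_of_int k))" for \<theta>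
  have "(\<integral>\<theta>. cis (2 * pi * real_of_int k * \<theta>) \<partial>unit_interval)
      = (\<integral>\<theta>. indicator {0..1} \<theta> *\<^sub>R cis (2 * pi * real_of_int k * \<theta>) \<partial>lborel)"
    by (subst integral_restrict_space) auto
  also have "\<dots> = F 1 - F 0"
  proof (rule integral_FTC_Icc)
    show "(F has_vector_derivative cis (2 * pi * real_of_int k * x)) (at x within {0..1})" for x
      unfolding F_def cis_conv_exp using False
      by (auto intro!: derivative_eq_intros has_vector_derivative_real_field simp: field_simps)
    show "continuous_on {0..1} (\<lambda>\<theta>. cis (2 * pi * real_of_int k * \<theta>))"
      by (intro continuous_intros)
  qed auto
  also have "\<dots> = 0"
    by (simp add: F_def cis_multiple_2pi)
  finally show ?thesis
    using False by simp
qed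

lemma measurable_cis: "(\<lambda>\<theta>. cis (2 * pi * c * \<theta>)) \<in> borel_measurable unit_interval"
proof -
  have "(\<lambda>\<theta>. cis (2 * pi * c * \<theta>)) \<in> borel_measurable borel"
    by (intro borel_measurable_continuous_onI continuous_intros)
  then show ?thesis
    by (intro measurable_restrict_space1) simp
qed

text \<open>\<open>x n\<close> is the \<open>n\<close>-th Fourier coefficient of the sum, and
  absolute summability permits termwise integration.\<close>

lemma norm_coeff_le_integral:
  fixes x :: "nat \<Rightarrow> complex"
  assumes "summable (\<lambda>m. norm (x m))"
  shows "norm (x n) \<le> (\<integral>\<theta>. norm (\<Sum>m. cis (2 * pi * real m * \<theta>) * x m) \<partial>unit_interval)"
proof -
  interpret prob_space unit_interval
    by (rule prob_space_unit_interval)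
  note measurable_cis[measurable]
  \<comment> \<open>The \<open>m\<close>-th term shifted in frequency by \<open>- n\<close>, so that
    only \<open>m = n\<close> has a nonzero integral.\<close>
  define h where "h m \<theta> = cis (2 * pi * real_of_int (int m - int n) * \<theta>) * x m" for m \<theta>
  have int: "integrable unit_interval (h m)" for m
    unfolding h_def
    by (intro integrable_mult_left integrable_const_bound[where B = 1]) auto
  have h: "h m \<theta> = cis (- (2 * pi * real n * \<theta>)) * (cis (2 * pi * real m * \<theta>) * x m)" for m \<theta>
  proof -
    have "2 * pi * real_of_int (int m - int n) * \<theta> = - (2 * pi * real n * \<theta>) + 2 * pi * real m * \<theta>"
      by (simp add: algebra_simps)
    then show ?thesis
      unfolding h_def by (simp only: cis_mult[symmetric] mult.assoc)
  qed
  have norm_h: "norm (h m \<theta>) = norm (x m)" for m \<theta>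
    by (simp add: h_def norm_mult)
  have summ: "summable (\<lambda>m. cis (2 * pi * real m * \<theta>) * x m)" for \<theta>
    by (rule summable_norm_cancel) (use assms in \<open>simp add: norm_mult\<close>)
  have "(\<integral>\<theta>. (\<Sum>m. h m \<theta>) \<partial>unit_interval) = (\<Sum>m. \<integral>\<theta>. h m \<theta> \<partial>unit_interval)"
    by (rule integral_suminf) (use assms int in \<open>auto simp: norm_h prob_space\<close>)
  also have "(\<lambda>m. \<integral>\<theta>. h m \<theta> \<partial>unit_interval) = (\<lambda>m. if m = n then x n else 0)"
    unfolding h_def by (subst integral_mult_left_zero, subst integral_cis) (auto simp: fun_eq_iff)
  also have "(\<Sum>m. if m = n then x n else 0) = x n"
    using sums_single[of n "\<lambda>_. x n"] by (simp add: sums_iff)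
  finally have "norm (x n) \<le> (\<integral>\<theta>. norm (\<Sum>m. h m \<theta>) \<partial>unit_interval)"
    using integral_norm_bound[of unit_interval "\<lambda>\<theta>. \<Sum>m. h m \<theta>"] by simp
  also have "(\<lambda>\<theta>. norm (\<Sum>m. h m \<theta>)) = (\<lambda>\<theta>. norm (\<Sum>m. cis (2 * pi * real m * \<theta>) * x m))"
    unfolding h by (subst suminf_mult[OF summ]) (simp add: norm_mult)
  finally show ?thesis .
qed

text \<open>Termwise differentiation on a ball around 0 containing the given point: the bound makes
  the differentiated series converge uniformly there, and complex linearity passes to the
  sum.\<close>

lemma entire_suminf:
  fixes F :: "nat \<Rightarrow> complex ^ 'd \<Rightarrow> complex"
  assumes deriv: "\<And>m z. (F m has_derivative F' m z) (at z)"
    and linear: "\<And>m z c v. F' m z (c *s v) = c * F' m z v"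
    and bound: "\<And>R. \<exists>B. summable B \<and> (\<forall>m z v. norm z \<le> R \<longrightarrow> norm (F' m z v) \<le> B m * norm v)"
    and summ: "\<And>z. summable (\<lambda>m. F m z)"
  shows "entire (\<lambda>z. \<Sum>m. F m z)"
  unfolding entire_def
proof
  fix z0 :: "complex ^ 'd"
  define S where "S = ball (0 :: complex ^ 'd) (norm z0 + 1)"
  define G where "G z v = (\<Sum>m. F' m z v)" for z v
  obtain B where B: "summable B" "\<And>m z v. norm z \<le> norm z0 + 1 \<Longrightarrow> norm (F' m z v) \<le> B m * norm v"
    using bound by meson
  have B': "norm (F' m z v) \<le> B m * norm v" if "z \<in> S" for m z v
    using that B(2) by (simp add: S_def)
  have summ_v: "summable (\<lambda>m. norm (F' m z v))" if "z \<in> S" for z v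
    by (rule summable_comparison_test_ev[OF _ summable_mult2[OF B(1), of "norm v"]])
      (use B' that in auto)
  have tail: "\<forall>\<^sub>F n in sequentially. \<forall>z\<in>S. \<forall>v. norm ((\<Sum>i<n. F' i z v) - G z v) \<le> e * norm v"
    if e: "e > 0" for e
  proof -
    obtain N where N: "\<And>n. n \<ge> N \<Longrightarrow> norm (\<Sum>i. B (i + n)) < e"
      using suminf_exist_split[OF e B(1)] by blast
    show ?thesis
      unfolding eventually_sequentially
    proof (intro exI allI impI ballI)
      fix n z v assume n: "N \<le> n" and z: "z \<in> S"
      have "(\<Sum>i<n. F' i z v) - G z v = - (\<Sum>i. F' (i + n) z v)"
        unfolding G_def suminf_split_initial_segment[OF summable_norm_cancel[OF summ_v[OF z]], of v n]
        by simp
      then have "norm ((\<Sum>i<n. F' i z v) - G z v) = norm (\<Sum>i. F' (i + n) z v)"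
        by simp
      also have "\<dots> \<le> (\<Sum>i. norm (F' (i + n) z v))"
        by (rule summable_norm) (use summ_v[OF z] in \<open>simp add: summable_iff_shift[of "\<lambda>i. norm (F' i z v)"]\<close>)
      also have "\<dots> \<le> (\<Sum>i. B (i + n) * norm v)"
        by (rule suminf_le)
          (use summ_v[OF z] B(1) B'[OF z] in \<open>auto simp: summable_iff_shift[of "\<lambda>i. norm (F' i z v)"]
            summable_iff_shift[of B] intro!: summable_mult2\<close>)
      also have "\<dots> = (\<Sum>i. B (i + n)) * norm v"
        by (rule suminf_mult2[symmetric]) (use B(1) in \<open>simp add: summable_iff_shift[of B]\<close>)
      also have "\<dots> \<le> e * norm v"
        using N[OF n] by (intro mult_right_mono) auto
      finally show "norm ((\<Sum>i<n. F' i z v) - G z v) \<le> e * norm v" .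
    qed
  qed
  have "\<exists>g. \<forall>z\<in>S. (\<lambda>n. F n z) sums g z \<and> (g has_derivative G z) (at z within S)"
    by (rule has_derivative_series[where f' = F' and x = z0])
      (use tail deriv summ in \<open>auto simp: S_def summable_sums intro: has_derivative_at_withinI\<close>)
  then obtain g where g: "\<And>z. z \<in> S \<Longrightarrow> (\<lambda>n. F n z) sums g z"
    "\<And>z. z \<in> S \<Longrightarrow> (g has_derivative G z) (at z within S)"
    by blast
  have "z0 \<in> S" "open S"
    by (auto simp: S_def)
  then have "(g has_derivative G z0) (at z0)"
    using g(2) by (metis at_within_open)
  then have "((\<lambda>z. \<Sum>m. F m z) has_derivative G z0) (at z0)"
    by (rule has_derivative_transform_within_open[OF _ \<open>open S\<close> \<open>z0 \<in> S\<close>])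
      (use g(1) in \<open>auto simp: sums_iff\<close>)
  moreover have "G z0 (c *s v) = c * G z0 v" for c v
    unfolding G_def linear
    by (rule suminf_mult[OF summable_norm_cancel[OF summ_v[OF \<open>z0 \<in> S\<close>]]])
  ultimately show "\<exists>f'. ((\<lambda>z. \<Sum>m. F m z) has_derivative f') (at z0) \<and> (\<forall>c v. f' (c *s v) = c * f' v)"
    by blast
qed

text \<open>Rows of finite length are padded with zeros and enumerated by
  \<open>prod_decode\<close>. A code is at least its row index, so the first \<open>M\<close> codes
  only visit rows below \<open>M\<close>.\<close>

lemma sum_prod_decode_le:
  fixes g :: "nat \<Rightarrow> nat \<Rightarrow> real"
  assumes nonneg: "\<And>k i. 0 \<le> g k i" and row: "\<And>k. (\<Sum>i<N k. g k i) \<le> B k"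
    and total: "\<And>K. (\<Sum>k<K. B k) \<le> S"
  shows "(\<Sum>m<M. case prod_decode m of (k, i) \<Rightarrow> if i < N k then g k i else 0) \<le> S"
proof -
  define h where "h = (\<lambda>(k, i). if i < N k then g k i else 0)"
  have "(\<Sum>m<M. case prod_decode m of (k, i) \<Rightarrow> if i < N k then g k i else 0) = (\<Sum>m<M. h (prod_decode m))"
    by (simp add: h_def)
  also have "\<dots> = sum h (prod_decode ` {..<M})"
    by (simp add: sum.reindex inj_on_def prod_decode_eq)
  also have "\<dots> = sum h (prod_decode ` {..<M} \<inter> {x. snd x < N (fst x)})"
    by (rule sum.mono_neutral_right) (auto simp: h_def case_prod_beta split: if_splits)
  also have "\<dots> \<le> sum h (SIGMA k:{..<M}. {..<N k})"
  proof (rule sum_mono2)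
    show "prod_decode ` {..<M} \<inter> {x. snd x < N (fst x)} \<subseteq> (SIGMA k:{..<M}. {..<N k})"
    proof
      fix x assume x: "x \<in> prod_decode ` {..<M} \<inter> {x. snd x < N (fst x)}"
      then have "prod_encode x < M"
        by auto
      then have "fst x < M"
        using le_prod_encode_1[of "fst x" "snd x"] by simp
      with x show "x \<in> (SIGMA k:{..<M}. {..<N k})"
        by (cases x) auto
    qed
  qed (use nonneg in \<open>auto simp: h_def\<close>)
  also have "\<dots> = (\<Sum>k<M. \<Sum>i<N k. g k i)"
    by (subst sum.Sigma) (auto simp: h_def intro!: sum.cong)
  also have "\<dots> \<le> (\<Sum>k<M. B k)"
    by (intro sum_mono row)
  also have "\<dots> \<le> S"
    by (rule total)
  finally show ?thesis .
qed

section \<open>Carleson measures\<close>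

lemma continuous_on_entire: "entire f \<Longrightarrow> continuous_on UNIV f"
proof (rule continuous_at_imp_continuous_on, rule ballI)
  fix z assume "entire f"
  then obtain f' where "(f has_derivative f') (at z)"
    unfolding entire_def by blast
  then show "isCont f z"
    by (rule has_derivative_continuous)
qed

text \<open>Chain rule; complex linearity of the derivative turns \<open>f' (h *s y)\<close> into
  multiplication of \<open>h\<close> by \<open>f' y\<close>.\<close>

lemma entire_imp_holomorphic_on_line:
  assumes "entire f" shows "(\<lambda>w. f (w *s y)) holomorphic_on UNIV"
proof (rule holomorphic_onI)
  fix w :: complex
  obtain f' where f': "(f has_derivative f') (at (w *s y))" "\<And>c v. f' (c *s v) = c * f' v"
    using assms unfolding entire_def by blast
  have lin: "bounded_linear (\<lambda>h. h *s y)"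
  proof -
    have "linear (\<lambda>h. h *s y)"
      by (rule linearI) (auto simp: vec_eq_iff ring_distribs)
    then show ?thesis
      by (simp add: linear_conv_bounded_linear)
  qed
  have "((\<lambda>w. f (w *s y)) has_derivative (\<lambda>h. f' (h *s y))) (at w)"
    by (rule has_derivative_compose[OF bounded_linear_imp_has_derivative[OF lin] f'(1)])
  also have "(\<lambda>h. f' (h *s y)) = (*) (f' y)"
    by (simp add: f'(2) fun_eq_iff mult.commute)
  finally have "((\<lambda>w. f (w *s y)) has_field_derivative f' y) (at w)"
    by (simp add: has_field_derivative_def)
  then show "(\<lambda>w. f (w *s y)) field_differentiable at w within UNIV"
    by (auto simp: field_differentiable_def)
qed

section \<open>The test functions and the two implications\<close>

context touching_monomials
begin

text \<open>The restriction of \<open>f / C\<close> to the complex line through \<open>z\<close>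
  competes in the supremum defining the associated weight.\<close>

lemma norm_entire_le_associated_weight:
  assumes "entire f" and "0 < C" and bound: "\<And>z. cmod (f z) \<le> C * \<omega> (norm z)"
  shows "cmod (f z) \<le> C * associated_weight \<omega> (norm z)"
proof -
  obtain y where y: "norm y = 1" "z = complex_of_real (norm z) *s y"
    using ex_unit_direction by blast
  define h where "h w = f (w *s y) / of_real C" for w
  have "h holomorphic_on UNIV"
    unfolding h_def using \<open>0 < C\<close>
    by (intro holomorphic_intros entire_imp_holomorphic_on_line[OF assms(1)]) auto
  moreover have "cmod (h w) \<le> \<omega> (cmod w)" for w
    using bound[of "w *s y"] y(1) \<open>0 < C\<close> by (simp add: h_def norm_divide norm_smult field_simps)
  ultimately have "cmod (h (of_real (norm z))) \<le> associated_weight \<omega> (cmod (of_real (norm z)))"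
    by (rule le_associated_weight)
  then show ?thesis
    using \<open>0 < C\<close> y(2) by (simp add: h_def norm_divide field_simps)
qed

lemma T_le_associated_weight:
  assumes "0 \<le> t" shows "T n t \<le> associated_weight \<omega> t"
proof -
  have "cmod (of_real (a n) * (of_real t) ^ n) \<le> associated_weight \<omega> (cmod (of_real t))"
  proof (rule le_associated_weight)
    show "cmod (of_real (a n) * w ^ n) \<le> \<omega> (cmod w)" for w
      using monomial_le[of "cmod w" n] coeff_pos[of n] by (simp add: norm_mult norm_power)
  qed (intro holomorphic_intros)
  then show ?thesis
    using assms coeff_pos[of n] by (simp add: norm_mult norm_power T_def)
qed

text \<open>The terms enumerate \<open>a (degrees k) * hprod z \<xi> ^ degrees k\<close> over all
  \<open>k\<close> and all points of the family of that degree. The upper estimate combines the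
  bound for each family with \<open>sum_degrees_le\<close>; it holds for partial sums of moduli, so
  it survives arbitrary phases.\<close>

lemma ex_entire_terms:
  "\<exists>(x :: nat \<Rightarrow> complex ^ 'd \<Rightarrow> complex) C. 0 < C \<and> (\<forall>m. continuous_on UNIV (x m)) \<and>
     (\<forall>\<epsilon>. (\<forall>m. cmod (\<epsilon> m) \<le> 1) \<longrightarrow> entire (\<lambda>z. \<Sum>m. \<epsilon> m * x m z)) \<and>
     (\<forall>z K M. (\<forall>n. T n (norm z) \<le> T K (norm z)) \<longrightarrow> (\<Sum>m<M. cmod (x m z)) \<le> C * T K (norm z)) \<and>
     (\<forall>z n. \<exists>m. T n (norm z) \<le> 4 * cmod (x m z))"
proof -
  let ?D = "2 * CARD('d)"
  obtain C0 :: real and X :: "nat \<Rightarrow> (complex ^ 'd) set" where C0: "0 < C0"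
    and X: "\<And>n. finite (X n)" "\<And>n x. x \<in> X n \<Longrightarrow> norm x = 1"
    "\<And>n. real (card (X n)) \<le> (5 + 4 * real n) ^ ?D"
    "\<And>n z. (\<Sum>x\<in>X n. cmod (hprod z x) ^ n) \<le> C0 * norm z ^ n"
    "\<And>n z. \<exists>x\<in>X n. norm z ^ n \<le> 2 * cmod (hprod z x) ^ n"
    using ex_homogeneous_family[where 'd = 'd] by metis
  define N where "N k = card (X (degrees k))" for k
  have "\<exists>\<xi>. bij_betw \<xi> {..<N k} (X (degrees k))" for k
    using ex_bij_betw_nat_finite[OF X(1)] unfolding N_def atLeast0LessThan by blast
  then obtain \<xi> where \<xi>: "\<And>k. bij_betw (\<xi> k) {..<N k} (X (degrees k))"
    by metis
  have \<xi>_norm: "norm (\<xi> k i) = 1" if "i < N k" for k i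
    using X(2) \<xi>[of k] that by (auto simp: bij_betw_def)
  define p where "p m = degrees (fst (prod_decode m))" for m
  \<comment> \<open>Codes whose second component exceeds the size of the family receive the
    coefficient 0.\<close>
  define c where "c m = (if snd (prod_decode m) < N (fst (prod_decode m)) then a (p m) else 0)" for m
  define y where "y m = \<xi> (fst (prod_decode m)) (snd (prod_decode m))" for m
  define x where "x m z = complex_of_real (c m) * hprod z (y m) ^ p m" for m z
  have c0: "0 \<le> c m" for m
    using coeff_pos[of "p m"] by (simp add: c_def)
  have y1: "norm (y m) = 1" if "c m \<noteq> 0" for m
    using that \<xi>_norm by (auto simp: c_def y_def split: if_splits)
  have sum_le: "(\<Sum>m<M. cmod (x m z)) \<le> 8 * C0 * T K (norm z)"
    if peak: "\<And>n. T n (norm z) \<le> T K (norm z)" for z K M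
  proof -
    have "(\<Sum>m<M. cmod (x m z)) = (\<Sum>m<M. case prod_decode m of (k, i) \<Rightarrow>
        if i < N k then a (degrees k) * cmod (hprod z (\<xi> k i)) ^ degrees k else 0)"
      using coeff_pos by (intro sum.cong)
        (auto simp: x_def c_def y_def p_def norm_mult norm_power case_prod_beta less_imp_le)
    also have "\<dots> \<le> 8 * C0 * T K (norm z)"
    proof (rule sum_prod_decode_le)
      fix k
      have "(\<Sum>i<N k. a (degrees k) * cmod (hprod z (\<xi> k i)) ^ degrees k)
          = a (degrees k) * (\<Sum>x\<in>X (degrees k). cmod (hprod z x) ^ degrees k)"
        using sum.reindex_bij_betw[OF \<xi>[of k], of "\<lambda>x. cmod (hprod z x) ^ degrees k"]
        by (simp add: sum_distrib_left[symmetric])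
      also have "\<dots> \<le> a (degrees k) * (C0 * norm z ^ degrees k)"
        using X(4) coeff_pos[of "degrees k"] by (intro mult_left_mono) auto
      finally show "(\<Sum>i<N k. a (degrees k) * cmod (hprod z (\<xi> k i)) ^ degrees k)
          \<le> C0 * T (degrees k) (norm z)"
        by (simp add: T_def mult_ac)
    next
      fix L
      show "(\<Sum>k<L. C0 * T (degrees k) (norm z)) \<le> 8 * C0 * T K (norm z)"
        using sum_degrees_le[OF _ peak, of L] C0 by (simp add: sum_distrib_left[symmetric])
    qed (use coeff_pos in \<open>auto simp: less_imp_le\<close>)
    finally show ?thesis .
  qed
  have summ: "summable (\<lambda>m. cmod (x m z))" for z
  proof -
    obtain K where "\<And>n. T n (norm z) \<le> T K (norm z)"
      using ex_peak[of "norm z"] by auto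
    then show ?thesis
      by (intro summableI_nonneg_bounded[where x = "8 * C0 * T K (norm z)"] sum_le) auto
  qed
  have entire: "entire (\<lambda>z. \<Sum>m. \<epsilon> m * x m z)" if \<epsilon>: "\<And>m. cmod (\<epsilon> m) \<le> 1" for \<epsilon>
  proof (rule entire_suminf)
    define F' where "F' m z v = \<epsilon> m * (of_real (c m) * (of_nat (p m) * hprod v (y m) * hprod z (y m) ^ (p m - 1)))"
      for m and z v :: "complex ^ 'd"
    show "((\<lambda>z. \<epsilon> m * x m z) has_derivative F' m z) (at z)" for m z
      unfolding x_def F'_def
      by (intro has_derivative_mult_right has_derivative_power
          bounded_linear_imp_has_derivative bounded_linear_hprod)
    show "F' m z (b *s v) = b * F' m z v" for m z b v
      by (simp add: F'_def hprod_scale_left)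
    show "summable (\<lambda>m. \<epsilon> m * x m z)" for z
      by (rule summable_norm_cancel, rule summable_comparison_test_ev[OF _ summ[of z]])
        (use \<epsilon> in \<open>auto simp: norm_mult mult_left_le_one_le\<close>)
    show "\<exists>B. summable B \<and> (\<forall>m z v. norm z \<le> R \<longrightarrow> norm (F' m z v) \<le> B m * norm v)" for R
    proof -
      define r where "r = max R 1"
      have r: "1 \<le> r" "R \<le> r"
        by (auto simp: r_def)
      \<comment> \<open>\<open>b n\<close> bounds the derivatives of all terms of degree
        \<open>n\<close> together: the cardinality is polynomial in \<open>n\<close>, while
        \<open>T n r\<close> decays geometrically.\<close>
      define b where "b n = (5 + 4 * real n) ^ ?D * (real n * T n r)" for n
      have b0: "0 \<le> b n" for n
        using T_nonneg[of r n] r by (simp add: b_def)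
      have "summable b"
      proof (rule summable_comparison_test_ev)
        show "\<forall>\<^sub>F n in sequentially. norm (b n) \<le> (5 + 4 * real n) ^ ?D * real n / 2 ^ n * \<omega> (2 * r)"
        proof (intro always_eventually allI)
          fix n
          have "b n \<le> (5 + 4 * real n) ^ ?D * (real n * (\<omega> (2 * r) / 2 ^ n))"
            unfolding b_def using r by (intro mult_left_mono T_le_power) auto
          then show "norm (b n) \<le> (5 + 4 * real n) ^ ?D * real n / 2 ^ n * \<omega> (2 * r)"
            using b0[of n] by simp
        qed
        have "(\<lambda>n. (5 + 4 * real n) ^ ?D * real n / 2 ^ n) \<in> O(\<lambda>n. 1 / real n ^ 2)"
          by real_asymp
        then have "summable (\<lambda>n. (5 + 4 * real n) ^ ?D * real n / 2 ^ n)"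
          by (rule summable_comparison_test_bigo[rotated])
            (simp add: inverse_power_summable[of 2, unfolded inverse_eq_divide])
        then show "summable (\<lambda>n. (5 + 4 * real n) ^ ?D * real n / 2 ^ n * \<omega> (2 * r))"
          by (rule summable_mult2)
      qed
      define B where "B m = (case prod_decode m of (k, i) \<Rightarrow>
        if i < N k then real (degrees k) * T (degrees k) r else 0)" for m
      have g0: "0 \<le> real (degrees k) * T (degrees k) r" for k
        using T_nonneg[of r] r by simp
      have "summable B"
      proof (rule summableI_nonneg_bounded)
        show "0 \<le> B m" for m
          using g0 by (simp add: B_def split: prod.split)
        show "(\<Sum>m<M. B m) \<le> suminf b" for M
          unfolding B_def
        proof (rule sum_prod_decode_le[where g = "\<lambda>k i. real (degrees k) * T (degrees k) r"])
          show "(\<Sum>i<N k. real (degrees k) * T (degrees k) r) \<le> b (degrees k)" for k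
            using mult_right_mono[OF X(3)[of "degrees k"] g0[of k]] by (simp add: N_def b_def)
          show "(\<Sum>k<L. b (degrees k)) \<le> suminf b" for L
          proof -
            have "(\<Sum>k<L. b (degrees k)) = sum b (degrees ` {..<L})"
              using strict_mono_imp_inj_on[OF strict_mono_degrees]
              by (subst sum.reindex) (auto intro: inj_on_subset)
            also have "\<dots> \<le> suminf b"
              using \<open>summable b\<close> b0 by (intro sum_le_suminf) auto
            finally show ?thesis .
          qed
        qed (rule g0)
      qed
      moreover have "norm (F' m z v) \<le> B m * norm v" if z: "norm z \<le> R" for m z v
      \<comment> \<open>Padding codes are set aside first, since \<open>y m\<close> is known to be a
        unit vector only for \<open>c m \<noteq> 0\<close>; a constant term has zero
        derivative.\<close>
      proof (cases "c m = 0 \<or> p m = 0")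
        case True
        then show ?thesis
          using g0 by (auto simp: F'_def B_def split: prod.split)
      next
        case False
        have hz: "cmod (hprod z (y m)) \<le> r"
          using norm_hprod_le[of z "y m"] y1[of m] False z r by simp
        have hv: "cmod (hprod v (y m)) \<le> norm v"
          using norm_hprod_le[of v "y m"] y1[of m] False by simp
        have "cmod (hprod z (y m)) ^ (p m - 1) \<le> r ^ (p m - 1)"
          using hz by (intro power_mono) auto
        also have "\<dots> \<le> r ^ p m"
          using r by (intro power_increasing) auto
        finally have hz': "cmod (hprod z (y m)) ^ (p m - 1) \<le> r ^ p m" .
        have "norm (F' m z v)
            = cmod (\<epsilon> m) * (c m * (real (p m) * cmod (hprod v (y m)) * cmod (hprod z (y m)) ^ (p m - 1)))"
          using c0[of m] by (simp add: F'_def norm_mult norm_power)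
        also have "\<dots> \<le> 1 * (c m * (real (p m) * norm v * r ^ p m))"
          using \<epsilon>[of m] c0[of m] hv hz' r
          by (intro mult_mono mult_nonneg_nonneg order_refl) auto
        also have "\<dots> = B m * norm v"
          using False by (auto simp: B_def c_def p_def T_def case_prod_beta split: if_splits)
        finally show ?thesis .
      qed
      ultimately show ?thesis
        by blast
    qed
  qed
  have lower: "\<exists>m. T n (norm z) \<le> 4 * cmod (x m z)" for z n
  proof -
    have "\<exists>k. T n (norm z) \<le> 2 * T (degrees k) (norm z)"
    proof (cases "z = 0")
      case True
      then show ?thesis
        using coeff_pos[of 0] by (intro exI[of _ 0]) (auto simp: T_def power_0_left)
    next
      case False
      then show ?thesis
        by (intro T_le_degrees) auto
    qed
    \<comment> \<open>One factor 2 is lost in passing to a selected degree, another in passing to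
      one point of the family.\<close>
    then obtain k where k: "T n (norm z) \<le> 2 * T (degrees k) (norm z)"
      by blast
    obtain i where i: "i < N k" "norm z ^ degrees k \<le> 2 * cmod (hprod z (\<xi> k i)) ^ degrees k"
    proof -
      obtain w where w: "w \<in> X (degrees k)" "norm z ^ degrees k \<le> 2 * cmod (hprod z w) ^ degrees k"
        using X(5) by blast
      then obtain i where "i < N k" "w = \<xi> k i"
        using \<xi>[of k] by (auto simp: bij_betw_def)
      with w that show ?thesis
        by blast
    qed
    have "T (degrees k) (norm z) \<le> a (degrees k) * (2 * cmod (hprod z (\<xi> k i)) ^ degrees k)"
      unfolding T_def using i(2) coeff_pos[of "degrees k"] by (intro mult_left_mono) auto
    also have "\<dots> = 2 * cmod (x (prod_encode (k, i)) z)"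
      using i(1) coeff_pos[of "degrees k"]
      by (simp add: x_def c_def p_def y_def norm_mult norm_power less_imp_le)
    finally show ?thesis
      using k by (intro exI[of _ "prod_encode (k, i)"]) auto
  qed
  have "continuous_on UNIV (x m)" for m
    unfolding x_def
    by (intro continuous_intros linear_continuous_on bounded_linear_hprod)
  with entire sum_le lower C0 show ?thesis
    by (intro exI[of _ x] exI[of _ "8 * C0"]) auto
qed

lemma Carleson_imp_integrable_associated_weight:
  fixes \<mu> :: "(complex ^ 'd) measure"
  assumes sets: "sets \<mu> = sets borel" and q: "0 < q"
    and carleson: "Carleson_measure q (growth_space \<omega>) \<mu>"
  shows "(\<integral>\<^sup>+ z. ennreal (associated_weight \<omega> (norm z) powr q) \<partial>\<mu>) < \<infinity>"
proof -
  have space: "space \<mu> = UNIV"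
    using sets_eq_imp_space_eq[OF sets] by simp
  have \<omega>_pos: "0 < \<omega> (norm z)" for z :: "complex ^ 'd"
    using weight_zero_pos weight_le[of 0 "norm z"] by simp
  have fin: "(\<integral>\<^sup>+ z. ennreal (norm (f z) powr q) \<partial>\<mu>) < \<infinity>"
    if "entire f" "\<And>z. norm (f z) \<le> C * \<omega> (norm z)" for f C
  proof -
    have "bdd_above (range (\<lambda>z. norm (f z) / \<omega> (norm z)))"
      using that(2) \<omega>_pos by (intro bdd_aboveI[of _ C]) (auto simp: pos_divide_le_eq)
    then have "f \<in> growth_space \<omega>"
      using that(1) by (simp add: growth_space_def)
    then have "integrable \<mu> (\<lambda>z. norm (f z) powr q)"
      using carleson by (auto simp: Carleson_measure_def Lq_space_def)
    then show ?thesis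
      by (simp add: integrable_iff_bounded)
  qed
  obtain x :: "nat \<Rightarrow> complex ^ 'd \<Rightarrow> complex" and C where C: "0 < C"
    and cont: "\<forall>m. continuous_on UNIV (x m)"
    and entire: "\<forall>\<epsilon>. (\<forall>m. cmod (\<epsilon> m) \<le> 1) \<longrightarrow> entire (\<lambda>z. \<Sum>m. \<epsilon> m * x m z)"
    and upper: "\<forall>z K M. (\<forall>n. T n (norm z) \<le> T K (norm z)) \<longrightarrow> (\<Sum>m<M. cmod (x m z)) \<le> C * T K (norm z)"
    and lower: "\<forall>z n. \<exists>m. T n (norm z) \<le> 4 * cmod (x m z)"
    using ex_entire_terms[where 'd = 'd] by (elim exE conjE) (rule that)
  define f where "f \<theta> z = (\<Sum>m. cis (2 * pi * real m * \<theta>) * x m z)" for \<theta> z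
  have summ: "summable (\<lambda>m. cmod (x m z))"
    and f_le: "norm (f \<theta> z) \<le> C * associated_weight \<omega> (norm z)"
    and f_le': "norm (f \<theta> z) \<le> C * \<omega> (norm z)" for z \<theta>
  proof -
    obtain K where K: "\<forall>n. T n (norm z) \<le> T K (norm z)"
      using ex_peak[of "norm z"] by auto
    have partial: "(\<Sum>m<M. cmod (x m z)) \<le> C * T K (norm z)" for M
      using upper K by blast
    show summ: "summable (\<lambda>m. cmod (x m z))"
      by (intro summableI_nonneg_bounded[where x = "C * T K (norm z)"] partial) auto
    then have "norm (f \<theta> z) \<le> (\<Sum>m. cmod (x m z))"
      unfolding f_def using summable_norm[of "\<lambda>m. cis (2 * pi * real m * \<theta>) * x m z"]
      by (simp add: norm_mult)
    also have "\<dots> \<le> C * T K (norm z)"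
      by (intro suminf_le_const summ partial)
    finally have *: "norm (f \<theta> z) \<le> C * T K (norm z)" .
    show "norm (f \<theta> z) \<le> C * associated_weight \<omega> (norm z)"
      by (rule order_trans[OF *]) (use C in \<open>auto intro!: mult_left_mono T_le_associated_weight\<close>)
    show "norm (f \<theta> z) \<le> C * \<omega> (norm z)"
      by (rule order_trans[OF *]) (use C in \<open>auto intro!: mult_left_mono T_le_weight\<close>)
  qed
  show ?thesis
  proof (rule nn_integral_powr_finite_of_family[where f = f and B = C and b = "1 / 16"])
    show "prob_space unit_interval"
      by (rule prob_space_unit_interval)
    \<comment> \<open>Constants belong to the growth space because the weight is at least
      \<open>\<omega> 0\<close>; the Carleson property for them makes \<open>\<mu>\<close>
      finite.\<close>
    have "entire (\<lambda>z :: complex ^ 'd. 1)"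
      unfolding entire_def by (intro allI exI[of _ "\<lambda>_. 0"]) auto
    then have "(\<integral>\<^sup>+ z. ennreal (norm (1 :: complex) powr q) \<partial>\<mu>) < \<infinity>"
      using weight_zero_pos weight_le by (intro fin[where C = "1 / \<omega> 0"]) (auto simp: field_simps)
    then show "finite_measure \<mu>"
      by (intro finite_measureI) auto
    show "(\<lambda>x. f (fst x) (snd x)) \<in> borel_measurable (unit_interval \<Otimes>\<^sub>M \<mu>)"
      unfolding f_def
    proof (intro borel_measurable_suminf borel_measurable_times)
      fix m
      have "x m \<in> borel_measurable \<mu>"
        using spec[OF cont, of m] by (simp add: borel_measurable_continuous_onI measurable_cong_sets[OF sets refl])
      then show "(\<lambda>v. x m (snd v)) \<in> borel_measurable (unit_interval \<Otimes>\<^sub>M \<mu>)"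
        by (rule measurable_compose[OF measurable_snd])
      have "(\<lambda>\<theta>. cis (2 * pi * real m * \<theta>)) \<in> borel_measurable unit_interval"
        by (rule measurable_cis)
      then show "(\<lambda>v. cis (2 * pi * real m * fst v)) \<in> borel_measurable (unit_interval \<Otimes>\<^sub>M \<mu>)"
        by (rule measurable_compose[OF measurable_fst])
    qed
    show "(\<integral>\<^sup>+ z. ennreal (norm (f \<theta> z) powr q) \<partial>\<mu>) < \<infinity>" for \<theta>
    proof (rule fin)
      show "entire (f \<theta>)"
        unfolding f_def using spec[OF entire, of "\<lambda>m. cis (2 * pi * real m * \<theta>)"] by simp
    qed (rule f_le')
    show "norm (f \<theta> z) \<le> C * associated_weight \<omega> (norm z)" for \<theta> z
      by (rule f_le)
    \<comment> \<open>The constant is \<open>1 / (4 * 4)\<close>: the associated weight is at most 4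
      times a monomial, which is at most 4 times a single term, whose modulus is a Fourier
      coefficient of \<open>f\<close>.\<close>
    show "1 / 16 * associated_weight \<omega> (norm z) \<le> (\<integral>\<theta>. norm (f \<theta> z) \<partial>unit_interval)" for z
    proof -
      obtain n where n: "associated_weight \<omega> (norm z) \<le> 4 * T n (norm z)"
        using associated_weight_le_monomial[of "norm z"] by auto
      obtain m where "T n (norm z) \<le> 4 * cmod (x m z)"
        using lower by blast
      with n show ?thesis
        using norm_coeff_le_integral[OF summ[of z], of m] unfolding f_def by linarith
    qed
    show "0 \<le> associated_weight \<omega> (norm z)" for z :: "complex ^ 'd"
      by (rule associated_weight_nonneg) auto
  qed (use C q in auto)
qed

text \<open>After scaling, each function of the growth space is dominated pointwise by the
  associated weight.\<close>

lemma integrable_associated_weight_imp_Carleson: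
  fixes \<mu> :: "(complex ^ 'd) measure"
  assumes sets: "sets \<mu> = sets borel" and q: "0 < q"
    and fin: "(\<integral>\<^sup>+ z. ennreal (associated_weight \<omega> (norm z) powr q) \<partial>\<mu>) < \<infinity>"
  shows "Carleson_measure q (growth_space \<omega>) \<mu>"
  unfolding Carleson_measure_def Lq_space_def
proof clarify
  fix f :: "complex ^ 'd \<Rightarrow> complex" assume "f \<in> growth_space \<omega>"
  then have f: "entire f" "bdd_above (range (\<lambda>z. norm (f z) / \<omega> (norm z)))"
    by (auto simp: growth_space_def)
  then obtain C0 where C0: "\<And>z. norm (f z) / \<omega> (norm z) \<le> C0"
    by (auto simp: bdd_above_def)
  define C where "C = max C0 1"
  have C: "0 < C"
    by (simp add: C_def)
  have "norm (f z) \<le> C * \<omega> (norm z)" for z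
  proof -
    have "norm (f z) / \<omega> (norm z) \<le> C" "0 < \<omega> (norm z)"
      using C0[of z] weight_zero_pos weight_le[of 0 "norm z"] by (auto simp: C_def)
    then show ?thesis
      by (simp add: pos_divide_le_eq)
  qed
  then have le: "norm (f z) / C \<le> associated_weight \<omega> (norm z)" for z
    using norm_entire_le_associated_weight[OF f(1) C, of z] C by (simp add: field_simps)
  have meas[measurable]: "f \<in> borel_measurable \<mu>"
    using continuous_on_entire[OF f(1)]
    by (simp add: borel_measurable_continuous_onI measurable_cong_sets[OF sets refl])
  have "integrable \<mu> (\<lambda>z. (norm (f z) / C) powr q)"
  proof (rule integrableI_bounded)
    have "(\<integral>\<^sup>+ z. ennreal (norm ((norm (f z) / C) powr q)) \<partial>\<mu>)
        \<le> (\<integral>\<^sup>+ z. ennreal (associated_weight \<omega> (norm z) powr q) \<partial>\<mu>)"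
      using le C q by (intro nn_integral_mono ennreal_leI) (auto intro!: powr_mono2)
    with fin show "(\<integral>\<^sup>+ z. ennreal (norm ((norm (f z) / C) powr q)) \<partial>\<mu>) < \<infinity>"
      by (rule le_less_trans[rotated])
  qed measurable
  then have "integrable \<mu> (\<lambda>z. C powr q * (norm (f z) / C) powr q)"
    by (rule integrable_mult_right)
  then have "integrable \<mu> (\<lambda>z. norm (f z) powr q)"
    using C by (simp add: powr_mult[symmetric])
  with meas show "f \<in> borel_measurable \<mu> \<and> integrable \<mu> (\<lambda>z. norm (f z) powr q)"
    by blast
qed

end

theorem corollary3p1:
  fixes \<omega> :: "real \<Rightarrow> real"
    and \<mu> :: "(complex ^ 'd) measure"
    and q :: real
  assumes "weight_function \<omega>"
    and "sets \<mu> = sets borel"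
    and "0 < q"
  shows "Carleson_measure q (growth_space \<omega>) \<mu> \<longleftrightarrow>
    (\<integral>\<^sup>+ z. ennreal (associated_weight \<omega> (norm z) powr q) \<partial>\<mu>) < \<infinity>"
proof -
  obtain a \<tau> where "touching_monomials \<omega> a \<tau>"
    using ex_touching_monomials[OF assms(1)] by blast
  then interpret touching_monomials \<omega> a \<tau> .
  show ?thesis
    using Carleson_imp_integrable_associated_weight integrable_associated_weight_imp_Carleson assms(2,3)
    by blast
qed

end
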